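(* Assume that the sequence of impulse times $\mathfrak{T}=\{t_k\}_{k\in\mathbb{Z}_{\ge1}}$ is given. Consider the time-varying positive impulsive system (for $0\le t_0<t_1$) $$\dot x(t)=\tilde A(t)x(t),\ t\in(t_k,t_{k+1}],\ k\in\mathbb{Z}_{\ge0};\qquad x(t_k^+)=\tilde J(k)x(t_k),\ k\in\mathbb{Z}_{\ge1};\qquad x(t_0^+)=x(t_0)=x_0.$$ Then the following statements are equivalent: (a) The system is uniformly exponentially stable. (b) There exist positive vectors $\bar\xi_1,\bar\xi_2\in\mathbb{R}^n_{>0}$, $0<\bar\xi_1\le\bar\xi_2$, and a piecewise continuously differentiable vector-valued function $\xi:[t_0,\infty)\to\mathbb{R}^n$, verifying $\bar\xi_1<\xi(t)<\bar\xi_2$, $t\ge t_0$, such that the function $$V(t,x(t))=\max_{i\in\{1,\ldots,n\}}\frac{x_i(t)}{\xi_i(t)}$$ is a uniform Lyapunov function for the system. (c) For any $b,d\in\mathbb{R}^n_{>0}$, the differential-difference inequality $$\begin{array}{rcl} -\dot\xi(t)+\tilde A(t)\xi(t)+b&<&0,\ t\in(t_k,t_{k+1}],\ k\in\mathbb{Z}_{\ge0},\\ \tilde J(k)\xi(t_k)-\xi(t_k^+)+d&<&0,\ k\in\mathbb{Z}_{\ge1} \end{array}$$ has a piecewise continuously differentiable positive solution $\xi(t)$ verifying $\bar\xi_1<\xi(t)<\bar\xi_2$ for some positive vectors $\bar\xi_1,\bar\xi_2\in\mathbb{R}^n_{>0}$, $0<\bar\xi_1\le\bar\xi_2$, for all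 $t\ge t_0$, and for all $0\le t_0<t_1$.
   Context: Inequalities are componentwise; $f(t^+)=\lim_{s\downarrow t}f(s)$. Impulse times satisfy $t_{k+1}-t_k>0$ and $t_k\to\infty$; $x(t)\in\mathbb{R}^n$ and solutions are left-continuous. $\tilde A$ is continuous and bounded on $\mathbb{R}_{\ge0}$, $\tilde J(k)$ is bounded in $k$. Positivity: $\tilde A(t)$ is Metzler (nonnegative off-diagonal entries) for all $t\ge0$ and $\tilde J(k)$ is nonnegative for all $k$. "Piecewise continuously differentiable": continuously differentiable on each $(t_k,t_{k+1}]$, $k\ge0$ (left-continuous at impulse times), with right limits $\xi(t_k^+)$. Uniform exponential stability: there exist $M>0$, $\rho\in(0,1)$, $\alpha>0$ such that $\|x(t)\|\le M\rho^{\kappa(t,t_0)}e^{-\alpha(t-t_0)}\|x_0\|$ for all $t\ge t_0$, all $x_0$ and all $t_0\in[0,t_1)$, where $\kappa(t,s)$ is the number of jumps between $s$ and $t$; equivalently the state-transition matrix satisfies $\|\tilde\Phi(t,s)\|\le M\rho^{\kappa(t,s)}e^{-\alpha(t-s)}$ for all $t\ge s\ge t_0$. Uniform Lyapunov function (on the nonnegative orthant): there are constants $c_1,c_2,\alpha>0$, $\rho\in(0,1)$ such that, along nonnegative trajectories, $c_1\|x\|_\infty\le V(t,x)\le c_2\|x\|_\infty$, the upper right derivative of $V$ is at most $-\alpha V$ during flows $t\in(t_k,t_{k+1}]$, and $V(t_k^+,x(t_k^+))\le\rho V(t_k,x(t_k))$ at jumps. *)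

theory Defs
  imports "HOL-Analysis.Analysis"
begin

(* Strict componentwise order. The library's "<" on vectors only means "\<le> and not \<ge>". *)
definition vec_less :: "real ^ 'n \<Rightarrow> real ^ 'n \<Rightarrow> bool"  (infix \<open>\<prec>\<close> 50)
  where "x \<prec> y \<longleftrightarrow> (\<forall>i. x $ i < y $ i)"

definition metzler :: "real ^ 'n ^ 'n \<Rightarrow> bool"
  where "metzler A \<longleftrightarrow> (\<forall>i j. i \<noteq> j \<longrightarrow> 0 \<le> A $ i $ j)"

definition nonneg_mat :: "real ^ 'n ^ 'n \<Rightarrow> bool"
  where "nonneg_mat A \<longleftrightarrow> (\<forall>i j. 0 \<le> A $ i $ j)"

definition right_lim :: "(real \<Rightarrow> 'a::t2_space) \<Rightarrow> real \<Rightarrow> 'a"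
  where "right_lim f t = Lim (at_right t) f"

definition upper_right_deriv :: "(real \<Rightarrow> real) \<Rightarrow> real \<Rightarrow> ereal"
  where "upper_right_deriv f t = Limsup (at_right 0) (\<lambda>h. ereal ((f (t + h) - f t) / h))"

(* Impulse times are \<tau> 1, \<tau> 2, ...; the value \<tau> 0 is never used.
   The set below is (t_k, t_{k+1}] restricted to times after s; for s = t_0 < t_1 it is
   exactly (t_k, t_{k+1}] for every k \<ge> 0. *)
definition flow_interval :: "(nat \<Rightarrow> real) \<Rightarrow> real \<Rightarrow> nat \<Rightarrow> real set"
  where "flow_interval \<tau> s k = {t. s < t \<and> (0 < k \<longrightarrow> \<tau> k < t) \<and> t \<le> \<tau> (Suc k)}"

(* x is a left-continuous solution on [s, \<infinity>) started at time s. At an impulse time the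
   derivative is the left one. If s is itself an impulse time, x s is the value before
   the jump, and the jump at s is carried out. *)
definition solution_from ::
  "(real \<Rightarrow> real ^ 'n ^ 'n) \<Rightarrow> (nat \<Rightarrow> real ^ 'n ^ 'n) \<Rightarrow> (nat \<Rightarrow> real)
    \<Rightarrow> real \<Rightarrow> (real \<Rightarrow> real ^ 'n) \<Rightarrow> bool"
  where "solution_from A J \<tau> s x \<longleftrightarrow>
    (\<forall>k. \<forall>t\<in>flow_interval \<tau> s k.
        (x has_vector_derivative A t *v x t) (at t within flow_interval \<tau> s k)) \<and>
    (\<forall>k\<ge>1. s \<le> \<tau> k \<longrightarrow> (x \<longlongrightarrow> J k *v x (\<tau> k)) (at_right (\<tau> k))) \<and>
    (s \<notin> \<tau> ` {1..} \<longrightarrow> (x \<longlongrightarrow> x s) (at_right s))"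

definition state_transition_matrix ::
  "(real \<Rightarrow> real ^ 'n ^ 'n) \<Rightarrow> (nat \<Rightarrow> real ^ 'n ^ 'n) \<Rightarrow> (nat \<Rightarrow> real)
    \<Rightarrow> (real \<Rightarrow> real \<Rightarrow> real ^ 'n ^ 'n) \<Rightarrow> bool"
  where "state_transition_matrix A J \<tau> \<Phi> \<longleftrightarrow>
    (\<forall>s\<ge>0. \<Phi> s s = mat 1 \<and> (\<forall>v. solution_from A J \<tau> s (\<lambda>t. \<Phi> t s *v v)))"

(* By left-continuity the value at t does not yet include a jump at t, whereas a jump at s
   acts on the value at s; hence jumps are counted in [s, t). *)
definition num_jumps :: "(nat \<Rightarrow> real) \<Rightarrow> real \<Rightarrow> real \<Rightarrow> nat"
  where "num_jumps \<tau> t s = card {k. 1 \<le> k \<and> s \<le> \<tau> k \<and> \<tau> k < t}"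

(* The estimate is required along trajectories started at every t_0 in [0, t_1) and for the
   state-transition matrix between all times t \<ge> s \<ge> t_0. The second part is the uniform one:
   it implies the first, but not conversely (e.g. when some J k is singular). *)
definition uniformly_exp_stable ::
  "(real \<Rightarrow> real ^ 'n ^ 'n) \<Rightarrow> (nat \<Rightarrow> real ^ 'n ^ 'n) \<Rightarrow> (nat \<Rightarrow> real) \<Rightarrow> bool"
  where "uniformly_exp_stable A J \<tau> \<longleftrightarrow>
    (\<exists>\<Phi>. state_transition_matrix A J \<tau> \<Phi> \<and>
      (\<exists>M>0. \<exists>\<rho>\<in>{0<..<1}. \<exists>\<alpha>>0. \<forall>t0\<in>{0..<\<tau> 1}.
        (\<forall>x. solution_from A J \<tau> t0 x \<longrightarrow>
          (\<forall>t\<ge>t0. norm (x t) \<le> M * \<rho> ^ num_jumps \<tau> t t0 * exp (- \<alpha> * (t - t0)) * norm (x t0))) \<and>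
        (\<forall>s\<ge>t0. \<forall>t\<ge>s.
          onorm ((*v) (\<Phi> t s)) \<le> M * \<rho> ^ num_jumps \<tau> t s * exp (- \<alpha> * (t - s)))))"

(* No condition ties the value at t0 to the right limit at t0. *)
definition piecewise_C1 :: "(nat \<Rightarrow> real) \<Rightarrow> real \<Rightarrow> (real \<Rightarrow> real ^ 'n) \<Rightarrow> bool"
  where "piecewise_C1 \<tau> t0 \<xi> \<longleftrightarrow>
    (\<forall>k. (\<forall>t\<in>flow_interval \<tau> t0 k. \<xi> differentiable (at t within flow_interval \<tau> t0 k)) \<and>
      continuous_on (flow_interval \<tau> t0 k)
        (\<lambda>t. vector_derivative \<xi> (at t within flow_interval \<tau> t0 k))) \<and>
    (\<exists>l. (\<xi> \<longlongrightarrow> l) (at_right t0)) \<and>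
    (\<forall>k\<ge>1. \<exists>l. (\<xi> \<longlongrightarrow> l) (at_right (\<tau> k)))"

(* As usual for Lyapunov functions on the state space, the nonnegative trajectories may pass
   through any state x \<ge> 0 at any time s \<ge> t0, not only through those reachable from time t0.
   The jump condition reads V(t_k^+, x(t_k^+)) as the right limit of V(t, x(t)) at t_k. *)
definition uniform_lyapunov ::
  "(real \<Rightarrow> real ^ 'n ^ 'n) \<Rightarrow> (nat \<Rightarrow> real ^ 'n ^ 'n) \<Rightarrow> (nat \<Rightarrow> real) \<Rightarrow> real
    \<Rightarrow> (real \<Rightarrow> real ^ 'n \<Rightarrow> real) \<Rightarrow> bool"
  where "uniform_lyapunov A J \<tau> t0 V \<longleftrightarrow>
    (\<exists>c1>0. \<exists>c2>0. \<exists>\<alpha>>0. \<exists>\<rho>\<in>{0<..<1}. \<forall>s\<ge>t0. \<forall>x.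
      solution_from A J \<tau> s x \<and> (\<forall>t\<ge>s. 0 \<le> x t) \<longrightarrow>
        (\<forall>t\<ge>s. c1 * infnorm (x t) \<le> V t (x t) \<and> V t (x t) \<le> c2 * infnorm (x t)) \<and>
        (\<forall>k. \<forall>t\<in>flow_interval \<tau> t0 k. s \<le> t \<longrightarrow>
          upper_right_deriv (\<lambda>u. V u (x u)) t \<le> ereal (- \<alpha> * V t (x t))) \<and>
        (\<forall>k\<ge>1. s \<le> \<tau> k \<longrightarrow>
          (\<exists>L. ((\<lambda>u. V u (x u)) \<longlongrightarrow> L) (at_right (\<tau> k)) \<and> L \<le> \<rho> * V (\<tau> k) (x (\<tau> k)))))"

end

theory Submission
  imports Defs
begin

text \<open>The proof runs through the implications (a) to (c) to (b) to (a).

The first two of these steps rest on one fact: a Metzler flow and nonnegative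
jumps preserve the order, so a trajectory that starts below a supersolution of the system stays
below it. Order preservation on one flow interval (\<open>metzler_flow_nonneg\<close>) follows by applying
Gronwall's inequality to the sum of the squares of the negative parts of the components: as the
off-diagonal entries are nonnegative, the positive parts can only make this sum smaller.

\<^bold>\<open>From (a) to (c).\<close> Let \<open>\<xi>\<close> solve the forced system with flow
\<open>\<xi>' = A \<xi> + b + 1\<close>, jumps \<open>\<xi>(\<tau>\<^sub>k\<^sup>+) = J\<^sub>k \<xi>(\<tau>\<^sub>k) + d + 1\<close> and initial value \<open>1\<close> at time 0. The
inequalities hold with slack 1. Order preservation keeps \<open>\<xi>\<close> above a positive constant vector.
Boundedness is \<open>affine_solution_bounded\<close>. Usually it is read off the variation of constants
formula; here it follows from a bound on the whole future
of the state, \<open>\<parallel>\<Phi>(u,t) \<xi>(t)\<parallel> \<le> K \<rho>\<^sup>\<kappa> exp(-\<alpha> (u - t))\<close> for all \<open>u \<ge> t\<close>, with \<open>\<kappa>\<close> the number of jumps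
between \<open>t\<close> and \<open>u\<close>, which is propagated over short time steps. Over such a step the stable
part of the state loses a fixed proportion, and this pays for what the forcing adds.

\<^bold>\<open>From (c) to (b).\<close> Take \<open>b = d = 1\<close>. Since \<open>\<xi>\<close> is bounded, the slack in the differential
inequality lets \<open>exp(-\<alpha> t) \<xi>(t)\<close> remain a supersolution for a small \<open>\<alpha> > 0\<close>, and the slack at
the jumps gives a factor \<open>\<rho> < 1\<close>. The value \<open>V(t,x)\<close> is the least \<open>c\<close> with \<open>x \<le> c \<xi>(t)\<close>, so
comparison of \<open>x\<close> with multiples of \<open>\<xi>\<close> gives the decay of \<open>V\<close> along \<open>x\<close>, and with it the bound
on the upper right derivative.

\<^bold>\<open>From (b) to (a).\<close> The upper right derivative and the jump condition integrate to
\<open>V(t,x(t)) \<le> c \<rho>\<^sup>\<kappa> exp(-\<alpha> (t - s)) \<parallel>x(s)\<parallel>\<close> for nonnegative trajectories from any \<open>s \<ge> t\<^sub>0\<close>.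
Writing a vector as the difference of its positive and negative part extends the estimate to all
initial states, and boundedness of \<open>A\<close> covers the interval \<open>[0, t\<^sub>0]\<close>, which contains no impulse.

The transition matrix itself is built from solutions of the linear equation on each flow interval
(Banach's fixed point theorem in an exponentially weighted norm), which are then glued at the
impulse times.\<close>

section \<open>Global existence for differential equations with a Lipschitz right-hand side\<close>

lemma integral_from_has_vector_derivative:
  fixes f :: "real \<Rightarrow> 'a::banach"
  assumes "continuous_on {r..} f" "r \<le> t"
  shows "((\<lambda>u. integral {r..u} f) has_vector_derivative f t) (at t within {r..})"
proof -
  have "((\<lambda>u. integral {r..u} f) has_vector_derivative f t) (at t within {r..t+1})"
    using assms by (intro integral_has_vector_derivative continuous_on_subset[OF assms(1)]) auto
  moreover have "at t within {r..t+1} = at t within {r..}"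
    by (rule at_within_nhd[where S="{..<t+1}"]) auto
  ultimately show ?thesis by simp
qed

text \<open>For \<open>L > a\<close> the substitution \<open>y(t) = exp(L (t - r)) z(t)\<close> turns the Picard operator into a
contraction with constant \<open>a / L\<close> on bounded continuous functions. One application of Banach's
theorem therefore gives the solution on the whole half-line, without continuation of local solutions.\<close>
lemma global_picard_lindeloef:
  fixes f :: "real \<Rightarrow> 'a::banach \<Rightarrow> 'a"
  assumes cont: "\<And>z. continuous_on {r..} z \<Longrightarrow> continuous_on {r..} (\<lambda>t. f t (z t))"
    and lip: "\<And>t u v. r \<le> t \<Longrightarrow> norm (f t u - f t v) \<le> a * norm (u - v)"
    and bnd: "\<And>t. r \<le> t \<Longrightarrow> norm (f t 0) \<le> c"
    and a: "0 \<le> a"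
  obtains y where "y r = y0" "\<And>t. r \<le> t \<Longrightarrow> (y has_vector_derivative f t (y t)) (at t within {r..})"
proof -
  define L where "L = a + 1"
  have L: "0 < L" "a < L" using a by (auto simp: L_def)
  have c: "0 \<le> c" using bnd[of r] norm_ge_zero[of "f r 0"] by linarith
  define w where "w t = exp (L * (t - r))" for t
  have wpos: "0 < w t" for t by (simp add: w_def)
  have w1: "1 \<le> w t" if "r \<le> t" for t using that L by (simp add: w_def)
  define g where "g z u = f u (w u *\<^sub>R z u)" for z u
  \<comment> \<open>Times before \<open>r\<close> are moved to \<open>r\<close>, so that the operator acts on functions on the whole line.\<close>
  define T where "T z t = inverse (w (max r t)) *\<^sub>R (y0 + integral {r..max r t} (g z))"
    for z :: "real \<Rightarrow> 'a" and t
  have gcont: "continuous_on {r..} (g z)" if "continuous_on UNIV z" for z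
    unfolding g_def w_def
    by (rule cont) (intro continuous_intros continuous_on_subset[OF that], auto)
  have int_w: "((\<lambda>u. K * w u) has_integral K * ((w t - 1) / L)) {r..t}" if "r \<le> t" for K t
  proof -
    have "((\<lambda>u. K * w u) has_integral (K * (w t / L) - K * (w r / L))) {r..t}"
      using L that unfolding w_def
      by (intro fundamental_theorem_of_calculus)
        (auto intro!: derivative_eq_intros simp flip: has_real_derivative_iff_has_vector_derivative)
    then show ?thesis by (simp add: w_def diff_divide_distrib right_diff_distrib)
  qed
  have weight: "inverse (w t) * (K * ((w t - 1) / L)) \<le> K / L" if "0 \<le> K" for K t
  proof -
    have "inverse (w t) * (K * ((w t - 1) / L)) = K / L * (1 - inverse (w t))"
      using wpos[of t] L by (simp add: field_simps)
    also have "\<dots> \<le> K / L * 1" using wpos[of t] that L by (intro mult_left_mono) auto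
    finally show ?thesis by simp
  qed
  have norm_int: "inverse (w t) * norm (integral {r..t} h) \<le> K / L"
    if "r \<le> t" "0 \<le> K" "continuous_on {r..} h" "\<And>u. r \<le> u \<Longrightarrow> norm (h u) \<le> K * w u"
    for K t and h :: "real \<Rightarrow> 'a"
  proof -
    have "norm (integral {r..t} h) \<le> integral {r..t} (\<lambda>u. K * w u)"
      using that int_w[OF that(1), of K]
      by (intro integral_norm_bound_integral integrable_continuous_real[OF
            continuous_on_subset[OF that(3)]]) (auto simp: has_integral_iff)
    also have "\<dots> = K * ((w t - 1) / L)" using int_w[OF that(1), of K] by (simp add: has_integral_iff)
    finally have "inverse (w t) * norm (integral {r..t} h) \<le> inverse (w t) * (K * ((w t - 1) / L))"
      using wpos[of t] by (intro mult_left_mono) auto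
    then show ?thesis using weight[OF that(2), of t] by linarith
  qed
  have Icont: "continuous_on {r..} (\<lambda>t. integral {r..t} h)" if "continuous_on {r..} h" for h :: "real \<Rightarrow> 'a"
    unfolding continuous_on_eq_continuous_within
    by (auto intro: has_vector_derivative_continuous[OF integral_from_has_vector_derivative[OF that]])
  have Tb: "T z \<in> bcontfun" if "z \<in> bcontfun" for z
  proof -
    have zc: "continuous_on UNIV z" using that by (auto simp: bcontfun_def)
    have "\<exists>B. \<forall>u. norm (z u) \<le> B" using that by (auto simp: bcontfun_def bounded_iff)
    then obtain B where B: "norm (z u) \<le> B" for u by auto
    have B0: "0 \<le> B" using B[of r] norm_ge_zero[of "z r"] by linarith
    have gb: "norm (g z u) \<le> (c + a * B) * w u" if "r \<le> u" for u
    proof -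
      have "norm (g z u) \<le> norm (f u (w u *\<^sub>R z u) - f u 0) + norm (f u 0)"
        unfolding g_def using norm_triangle_ineq[of "f u (w u *\<^sub>R z u) - f u 0" "f u 0"] by simp
      also have "\<dots> \<le> a * (w u * norm (z u)) + c"
        using lip[OF that, of "w u *\<^sub>R z u" 0] bnd[OF that] wpos[of u] by simp
      also have "\<dots> \<le> a * (w u * B) + c * w u"
        using a B wpos[of u] w1[OF that] c
        by (intro add_mono mult_left_mono) (auto simp: mult_le_cancel_left1)
      finally show ?thesis by (simp add: algebra_simps)
    qed
    show ?thesis
    proof (rule bcontfun_normI)
      have "continuous_on UNIV (\<lambda>t. integral {r..max r t} (g z))"
        by (rule continuous_on_compose2[OF Icont[OF gcont[OF zc]]]) (auto intro!: continuous_intros)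
      then show "continuous_on UNIV (T z)"
        unfolding T_def w_def by (intro continuous_intros) auto
      fix t
      have "norm (T z t) \<le> inverse (w (max r t)) * norm y0
          + inverse (w (max r t)) * norm (integral {r..max r t} (g z))"
        unfolding T_def using wpos[of "max r t"]
        by (simp add: distrib_left[symmetric] norm_triangle_ineq)
      also have "\<dots> \<le> norm y0 + (c + a * B) / L"
        using w1[of "max r t"] a c B0
        by (intro add_mono norm_int gcont[OF zc] gb) (auto simp: mult_left_le_one_le inverse_le_1_iff)
      finally show "norm (T z t) \<le> norm y0 + (c + a * B) / L" .
    qed
  qed
  have contr: "norm (T z t - T z' t) \<le> a / L * D"
    if zc: "continuous_on UNIV z" "continuous_on UNIV z'" and D: "\<And>u. norm (z u - z' u) \<le> D" for z z' t D
  proof -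
    have D0: "0 \<le> D" using D[of r] norm_ge_zero[of "z r - z' r"] by linarith
    have gd: "norm (g z u - g z' u) \<le> (a * D) * w u" if u: "r \<le> u" for u
    proof -
      have "norm (g z u - g z' u) \<le> a * (w u * norm (z u - z' u))"
        unfolding g_def using lip[OF u, of "w u *\<^sub>R z u" "w u *\<^sub>R z' u"] wpos[of u]
        by (simp flip: scaleR_diff_right)
      also have "\<dots> \<le> a * (w u * D)"
        using a D wpos[of u] by (intro mult_left_mono) auto
      finally show ?thesis by (simp add: algebra_simps)
    qed
    have ig: "g x integrable_on {r..max r t}" if "continuous_on UNIV x" for x
      by (intro integrable_continuous_real continuous_on_subset[OF gcont[OF that]]) auto
    have "norm (T z t - T z' t)
        = inverse (w (max r t)) * norm (integral {r..max r t} (\<lambda>u. g z u - g z' u))"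
      using wpos[of "max r t"] ig[OF zc(1)] ig[OF zc(2)]
      by (simp add: T_def integral_diff flip: scaleR_diff_right)
    also have "\<dots> \<le> (a * D) / L"
      using a D0 gd by (intro norm_int continuous_intros gcont zc) auto
    finally show ?thesis by simp
  qed
  define TT where "TT z = Bcontfun (T (apply_bcontfun z))" for z :: "real \<Rightarrow>\<^sub>C 'a"
  have TT: "apply_bcontfun (TT z) = T (apply_bcontfun z)" for z
    unfolding TT_def using Tb[OF apply_bcontfun[of z]] by (simp add: Bcontfun_inverse)
  have "\<exists>!z. TT z = z"
  proof (rule banach_fix_type)
    show "\<forall>x y. dist (TT x) (TT y) \<le> a / L * dist x y"
    proof (intro allI dist_bound)
      fix x y t
      show "dist (TT x t) (TT y t) \<le> a / L * dist x y"
        unfolding TT dist_norm[of "T _ _"]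
        by (rule contr) (auto simp: dist_bounded simp flip: dist_norm)
    qed
  qed (use L a in auto)
  then obtain z where z: "TT z = z" by auto
  define y where "y t = w t *\<^sub>R apply_bcontfun z t" for t
  have yeq: "y t = y0 + integral {r..t} (\<lambda>u. f u (y u))" if "r \<le> t" for t
  proof -
    have "apply_bcontfun z t = T (apply_bcontfun z) t" using TT[of z] z by simp
    then show ?thesis using that wpos[of t] by (simp add: y_def T_def g_def[abs_def])
  qed
  have fy: "continuous_on {r..} (\<lambda>u. f u (y u))"
    using gcont[of "apply_bcontfun z"] by (simp add: g_def[abs_def] y_def)
  show ?thesis
  proof (rule that)
    show "y r = y0" using yeq[of r] by simp
    fix t assume t: "r \<le> t"
    have "((\<lambda>t. y0 + integral {r..t} (\<lambda>u. f u (y u))) has_vector_derivative f t (y t)) (at t within {r..})"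
      using integral_from_has_vector_derivative[OF fy t]
      by (auto intro!: derivative_eq_intros)
    then show "(y has_vector_derivative f t (y t)) (at t within {r..})"
      by (rule has_vector_derivative_transform[rotated 2]) (use t in \<open>auto simp: yeq\<close>)
  qed
qed



section \<open>Growth and positivity of linear flows\<close>

text \<open>The interval is open on the left and the initial value is a right limit: this is the situation
directly after an impulse, where the trajectory jumps at the left end point.\<close>
lemma gronwall_half_open:
  fixes f f' :: "real \<Rightarrow> real"
  assumes rq: "r < q"
    and der: "\<And>u. u \<in> {r<..q} \<Longrightarrow> (f has_real_derivative f' u) (at u within {r<..q})"
    and le: "\<And>u. u \<in> {r<..q} \<Longrightarrow> f' u \<le> c * f u"
    and lim: "(f \<longlongrightarrow> f0) (at_right r)"
  shows "f q \<le> f0 * exp (c * (q - r))"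
proof -
  define g where "g u = f u * exp (- c * u)" for u
  have decr: "g q \<le> g u" if u: "r < u" "u < q" for u
  proof (rule DERIV_nonpos_imp_decreasing_open[where f = g and a = u and b = q])
    show "u \<le> q" using u by simp
    have f_cont: "continuous_on {r<..q} f"
      unfolding continuous_on_eq_continuous_within by (intro ballI DERIV_continuous[OF der])
    then show "continuous_on {u..q} g" unfolding g_def
      by (intro continuous_intros continuous_on_subset[OF f_cont]) (use u in auto)
    fix x assume x: "u < x" "x < q"
    have "at x within {r<..q} = at x" using x u by (intro at_within_interior) auto
    then have "(f has_real_derivative f' x) (at x)" using der[of x] x u by auto
    then have "(g has_real_derivative (f' x - c * f x) * exp (- c * x)) (at x)"
      unfolding g_def by (auto intro!: derivative_eq_intros simp: algebra_simps)
    then show "\<exists>y. (g has_real_derivative y) (at x) \<and> y \<le> 0"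
      using le[of x] x u by (intro exI conjI) (auto simp: mult_nonpos_nonneg)
  qed
  have "eventually (\<lambda>u. u < q) (at_right r)"
    using rq by (auto simp: eventually_at_right)
  then have "eventually (\<lambda>u. g q \<le> g u) (at_right r)"
    using eventually_at_right_less[of r] by eventually_elim (use decr in auto)
  moreover have "(g \<longlongrightarrow> f0 * exp (- c * r)) (at_right r)"
    unfolding g_def by (intro tendsto_intros lim)
  ultimately have "g q \<le> f0 * exp (- c * r)"
    using tendsto_lowerbound trivial_limit_at_right_real by blast
  then have "g q * exp (c * q) \<le> f0 * exp (- c * r) * exp (c * q)" by (intro mult_right_mono) auto
  then show ?thesis by (simp add: g_def algebra_simps flip: exp_add)
qed

lemma vec_nth_has_real_derivative:
  assumes "(y has_vector_derivative y') F"
  shows "((\<lambda>u. y u $ i) has_real_derivative y' $ i) F"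
  using bounded_linear.has_vector_derivative[OF bounded_linear_vec_nth assms, of i]
  by (simp add: has_real_derivative_iff_has_vector_derivative)

text \<open>Squaring makes the negative part differentiable at 0 as well, so that Gronwall's inequality
applies to it.\<close>
lemma DERIV_negative_part_squared:
  "((\<lambda>x::real. (min x 0)\<^sup>2) has_real_derivative 2 * min x 0) (at x)"
proof (cases "x = 0")
  case True
  have "((\<lambda>h. (min h 0)\<^sup>2 / h) \<longlongrightarrow> 0) (at (0::real))"
  proof (rule Lim_null_comparison)
    show "\<forall>\<^sub>F h in at 0. norm ((min h 0)\<^sup>2 / h) \<le> \<bar>h\<bar>"
      by (auto simp: min_def power2_eq_square eventually_at intro!: exI[of _ 1])
    show "((\<lambda>h::real. \<bar>h\<bar>) \<longlongrightarrow> 0) (at 0)"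
      by (rule tendsto_eq_intros refl tendsto_ident_at)+ simp
  qed
  then show ?thesis using True by (simp add: DERIV_def)
next
  case False
  then consider "x < 0" | "0 < x" by linarith
  then show ?thesis
  proof cases
    case 1
    have "((\<lambda>x::real. x\<^sup>2) has_real_derivative 2 * min x 0) (at x)"
      using 1 by (auto intro!: derivative_eq_intros)
    then show ?thesis
      by (rule has_field_derivative_transform_within_open[where S = "{..<0}"]) (use 1 in auto)
  next
    case 2
    have "((\<lambda>x::real. 0) has_real_derivative 2 * min x 0) (at x)"
      using 2 by (auto intro!: derivative_eq_intros)
    then show ?thesis
      by (rule has_field_derivative_transform_within_open[where S = "{0<..}"]) (use 2 in auto)
  qed
qed

text \<open>Replacing \<open>y\<close> by its negative part drops the terms with the positive parts of the components:
off the diagonal these have the sign of \<open>n y $ i\<close>, and on the diagonal the product of the positive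
and the negative part of one component vanishes.\<close>
lemma metzler_negative_part:
  fixes A :: "real ^ 'n ^ 'n"
  assumes "metzler A"
  defines "n \<equiv> \<lambda>y::real ^ 'n. \<chi> j. min (y $ j) 0"
  shows "n y $ i * (A *v y) $ i \<le> n y $ i * (A *v n y) $ i"
proof -
  have "n y $ i * (A *v y) $ i - n y $ i * (A *v n y) $ i
      = (\<Sum>j\<in>UNIV. n y $ i * (A $ i $ j * max (y $ j) 0))"
    unfolding right_diff_distrib[symmetric] matrix_vector_mult_def
    by (simp add: n_def sum_distrib_left flip: sum_subtractf right_diff_distrib)
       (rule sum.cong, auto simp: min_def max_def algebra_simps)
  also have "\<dots> \<le> 0"
  proof (rule sum_nonpos)
    fix j show "n y $ i * (A $ i $ j * max (y $ j) 0) \<le> 0"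
    proof (cases "i = j")
      case True
      then show ?thesis by (simp add: n_def min_def max_def)
    next
      case False
      then have "0 \<le> A $ i $ j" using assms by (auto simp: metzler_def)
      then show ?thesis by (intro mult_nonpos_nonneg mult_nonneg_nonneg) (auto simp: n_def)
    qed
  qed
  finally show ?thesis by simp
qed

text \<open>The sum \<open>N\<close> of the squared negative parts satisfies \<open>N' \<le> 2 a N\<close> and tends to 0 at the left end, so
it vanishes.\<close>
lemma metzler_flow_nonneg:
  fixes y :: "real \<Rightarrow> real ^ 'n"
  assumes rq: "r < q"
    and der: "\<And>u. u \<in> {r<..q} \<Longrightarrow> (y has_vector_derivative y' u) (at u within {r<..q})"
    and le: "\<And>u. u \<in> {r<..q} \<Longrightarrow> A u *v y u \<le> y' u"
    and metzler: "\<And>u. u \<in> {r<..q} \<Longrightarrow> metzler (A u)"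
    and bound: "\<And>u v. u \<in> {r<..q} \<Longrightarrow> norm (A u *v v) \<le> a * norm v"
    and lim: "(y \<longlongrightarrow> y0) (at_right r)" and y0: "0 \<le> y0"
  shows "0 \<le> y q"
proof -
  define n where "n y = (\<chi> j. min (y $ j) 0)" for y :: "real ^ 'n"
  define N where "N u = (\<Sum>i\<in>UNIV. (min (y u $ i) 0)\<^sup>2)" for u
  have Nn: "N u = n (y u) \<bullet> n (y u)" for u
    by (simp add: N_def n_def inner_vec_def power2_eq_square)
  have "N q \<le> 0 * exp (2 * a * (q - r))"
  proof (rule gronwall_half_open[OF rq])
    show "(N has_real_derivative (\<Sum>i\<in>UNIV. 2 * min (y u $ i) 0 * y' u $ i)) (at u within {r<..q})"
      if "u \<in> {r<..q}" for u
      unfolding N_def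
      by (intro DERIV_sum DERIV_chain2[OF DERIV_negative_part_squared]
            vec_nth_has_real_derivative der that)
    fix u assume u: "u \<in> {r<..q}"
    have "(\<Sum>i\<in>UNIV. 2 * min (y u $ i) 0 * y' u $ i) \<le> (\<Sum>i\<in>UNIV. 2 * (n (y u) $ i * (A u *v n (y u)) $ i))"
    proof (rule sum_mono)
      fix i
      have "n (y u) $ i * y' u $ i \<le> n (y u) $ i * (A u *v y u) $ i"
        using le[OF u] by (intro mult_left_mono_neg) (auto simp: n_def less_eq_vec_def)
      also have "\<dots> \<le> n (y u) $ i * (A u *v n (y u)) $ i"
        unfolding n_def by (rule metzler_negative_part[OF metzler[OF u]])
      finally show "2 * min (y u $ i) 0 * y' u $ i \<le> 2 * (n (y u) $ i * (A u *v n (y u)) $ i)"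
        by (simp add: n_def)
    qed
    also have "\<dots> = 2 * (n (y u) \<bullet> (A u *v n (y u)))"
      by (simp add: inner_vec_def sum_distrib_left)
    also have "\<dots> \<le> 2 * (norm (n (y u)) * (a * norm (n (y u))))"
      using bound[OF u, of "n (y u)"] norm_cauchy_schwarz[of "n (y u)" "A u *v n (y u)"]
      by (smt (verit) mult_left_mono norm_ge_zero)
    also have "\<dots> = 2 * a * N u" by (simp add: Nn power2_norm_eq_inner[symmetric] power2_eq_square)
    finally show "(\<Sum>i\<in>UNIV. 2 * min (y u $ i) 0 * y' u $ i) \<le> 2 * a * N u" .
  next
    have "(N \<longlongrightarrow> (\<Sum>i\<in>UNIV. (min (y0 $ i) 0)\<^sup>2)) (at_right r)"
      unfolding N_def by (intro tendsto_intros lim)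
    moreover have "min (y0 $ i) 0 = 0" for i
      using y0 by (simp add: less_eq_vec_def min_absorb2)
    ultimately show "(N \<longlongrightarrow> 0) (at_right r)" by simp
  qed
  then have "N q = 0" using sum_nonneg[of UNIV "\<lambda>i. (min (y q $ i) 0)\<^sup>2"] by (simp add: N_def)
  then have "min (y q $ i) 0 = 0" for i by (simp add: N_def sum_nonneg_eq_0_iff)
  then have "0 \<le> y q $ i" for i by (metis min.cobounded1)
  then show ?thesis by (simp add: less_eq_vec_def)
qed

text \<open>Gronwall's inequality for \<open>\<parallel>y\<parallel>\<^sup>2 + \<parallel>b\<parallel>\<^sup>2\<close>. The added constant absorbs the inhomogeneous term; with
\<open>b = 0\<close> and \<open>y0 = 0\<close> the estimate is uniqueness of solutions.\<close>
lemma affine_flow_growth: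
  fixes y :: "real \<Rightarrow> real ^ 'n"
  assumes rq: "r < q"
    and der: "\<And>u. u \<in> {r<..q} \<Longrightarrow> (y has_vector_derivative A u *v y u + b) (at u within {r<..q})"
    and bound: "\<And>u v. u \<in> {r<..q} \<Longrightarrow> norm (A u *v v) \<le> a * norm v"
    and lim: "(y \<longlongrightarrow> y0) (at_right r)"
  shows "norm (y q) \<le> (norm y0 + norm b) * exp ((a + 1) * (q - r))"
proof -
  define f where "f u = y u \<bullet> y u + b \<bullet> b" for u
  have "f q \<le> (y0 \<bullet> y0 + b \<bullet> b) * exp ((2 * (a + 1)) * (q - r))"
  proof (rule gronwall_half_open[OF rq])
    show "(f has_real_derivative 2 * (y u \<bullet> (A u *v y u + b))) (at u within {r<..q})"
      if "u \<in> {r<..q}" for u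
      unfolding f_def has_real_derivative_iff_has_vector_derivative
      using has_vector_derivative_add[OF bounded_bilinear.has_vector_derivative[OF
            bounded_bilinear_inner der[OF that] der[OF that]] has_vector_derivative_const[of "b \<bullet> b"]]
      by (simp add: inner_commute)
    fix u assume u: "u \<in> {r<..q}"
    define Y B where "Y = norm (y u) * norm (y u)" and "B = norm b * norm b"
    have nonneg: "0 \<le> Y" "0 \<le> B" by (auto simp: Y_def B_def)
    have "0 \<le> a"
      using order_trans[OF norm_ge_zero bound[OF u, of "axis undefined 1"]] by simp
    then have aB: "0 \<le> a * B" using nonneg by simp
    have "y u \<bullet> (A u *v y u) \<le> norm (y u) * (a * norm (y u))"
      using bound[OF u, of "y u"] norm_cauchy_schwarz[of "y u" "A u *v y u"]
      by (smt (verit) mult_left_mono norm_ge_zero)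
    then have flow: "y u \<bullet> (A u *v y u) \<le> a * Y" by (simp add: Y_def algebra_simps)
    have forcing: "2 * (y u \<bullet> b) \<le> Y + B"
      using norm_cauchy_schwarz[of "y u" b] sum_squares_bound[of "norm (y u)" "norm b"]
      unfolding Y_def B_def power2_eq_square by linarith
    have "2 * (y u \<bullet> (A u *v y u + b)) = 2 * (y u \<bullet> (A u *v y u)) + 2 * (y u \<bullet> b)"
      by (simp add: inner_add_right)
    also have "\<dots> \<le> 2 * (a * Y) + 2 * (a * B) + 2 * Y + 2 * B"
      using flow forcing aB nonneg by linarith
    also have "\<dots> = 2 * (a + 1) * f u"
      by (simp add: f_def Y_def B_def norm_eq_sqrt_inner algebra_simps)
    finally show "2 * (y u \<bullet> (A u *v y u + b)) \<le> 2 * (a + 1) * f u" .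
  next
    show "(f \<longlongrightarrow> y0 \<bullet> y0 + b \<bullet> b) (at_right r)"
      unfolding f_def by (intro tendsto_intros lim)
  qed
  moreover have "y0 \<bullet> y0 + b \<bullet> b \<le> (norm y0 + norm b)\<^sup>2"
    by (simp add: power2_sum flip: power2_norm_eq_inner)
  ultimately have "(norm (y q))\<^sup>2 \<le> (norm y0 + norm b)\<^sup>2 * exp ((2 * (a + 1)) * (q - r))"
    by (simp add: f_def power2_norm_eq_inner)
       (smt (verit) exp_gt_zero inner_ge_zero mult_right_mono)
  also have "\<dots> = ((norm y0 + norm b) * exp ((a + 1) * (q - r)))\<^sup>2"
    by (simp add: power_mult_distrib flip: exp_double)
  finally show ?thesis by (rule power2_le_imp_le) auto
qed

text \<open>In contrast to the growth estimate this bound vanishes linearly with the length of the interval,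
which is what a comparison with the loss \<open>1 - exp(-\<alpha> (q - r))\<close> over a short step needs.\<close>
lemma affine_flow_deviation:
  fixes y :: "real \<Rightarrow> real ^ 'n"
  assumes rq: "r < q"
    and der: "\<And>u. u \<in> {r<..q} \<Longrightarrow> (y has_vector_derivative A u *v y u + b) (at u within {r<..q})"
    and bound: "\<And>u v. u \<in> {r<..q} \<Longrightarrow> norm (A u *v v) \<le> a * norm v"
    and lim: "(y \<longlongrightarrow> y0) (at_right r)"
  shows "norm (y q - y0) \<le> (a * ((norm y0 + norm b) * exp ((a + 1) * (q - r))) + norm b) * (q - r)"
    (is "_ \<le> ?B * _")
proof -
  have a: "0 \<le> a"
    using order_trans[OF norm_ge_zero bound[of q "axis undefined 1"]] rq by simp
  have slope: "norm (A u *v y u + b) \<le> ?B" if u: "u \<in> {r<..q}" for u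
  proof -
    have "norm (y u) \<le> (norm y0 + norm b) * exp ((a + 1) * (u - r))"
    proof (rule affine_flow_growth[where A = A])
      show "(y has_vector_derivative A x *v y x + b) (at x within {r<..u})" if "x \<in> {r<..u}" for x
        by (rule has_vector_derivative_within_subset[OF der]) (use that u in auto)
    qed (use u bound lim in auto)
    also have "\<dots> \<le> (norm y0 + norm b) * exp ((a + 1) * (q - r))"
      using u a by (intro mult_left_mono) auto
    finally have "a * norm (y u) \<le> a * ((norm y0 + norm b) * exp ((a + 1) * (q - r)))"
      using a by (rule mult_left_mono)
    then show ?thesis
      using bound[OF u, of "y u"] norm_triangle_ineq[of "A u *v y u" b] by linarith
  qed
  have "norm (y q - y u) \<le> ?B * (q - r)" if u: "r < u" "u < q" for u
  proof -
    have sub: "{u..q} \<subseteq> {r<..q}" using u by auto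
    have "norm (y q - y u) \<le> ?B * norm (q - u)"
    proof (rule differentiable_bound[of "{u..q}" _ "\<lambda>x h. h *\<^sub>R (A x *v y x + b)"])
      show "(y has_derivative (\<lambda>h. h *\<^sub>R (A x *v y x + b))) (at x within {u..q})"
        if "x \<in> {u..q}" for x
        using has_vector_derivative_within_subset[OF der[of x] sub] that sub
        by (auto simp: has_vector_derivative_def)
      show "onorm (\<lambda>h. h *\<^sub>R (A x *v y x + b)) \<le> ?B" if "x \<in> {u..q}" for x
        using slope[of x] that u by (intro onorm_le) (auto simp: mult.commute intro!: mult_left_mono)
    qed (use u in auto)
    also have "\<dots> \<le> ?B * (q - r)" using u a by (intro mult_left_mono) auto
    finally show ?thesis .
  qed
  then have "eventually (\<lambda>u. norm (y q - y u) \<le> ?B * (q - r)) (at_right r)"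
    using rq by (auto simp: eventually_at_right)
  moreover have "((\<lambda>u. norm (y q - y u)) \<longlongrightarrow> norm (y q - y0)) (at_right r)"
    by (intro tendsto_intros lim)
  ultimately show ?thesis by (intro tendsto_upperbound) auto
qed

section \<open>Exponential decay and upper right derivatives\<close>

text \<open>The bound on a limit superior is used only through this affine bound directly to the right of
\<open>t\<close>.\<close>
lemma upper_right_deriv_le:
  assumes "upper_right_deriv f t \<le> ereal c" "c < c'"
  shows "eventually (\<lambda>u. f u \<le> f t + c' * (u - t)) (at_right t)"
proof -
  have "Limsup (at_right 0) (\<lambda>h. ereal ((f (t + h) - f t) / h)) < ereal c'"
    using assms unfolding upper_right_deriv_def by (meson ereal_less(2) le_less_trans less_ereal.simps(1))
  then have "eventually (\<lambda>h. ereal ((f (t + h) - f t) / h) < ereal c') (at_right 0)"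
    by (rule Limsup_lessD)
  then have "eventually (\<lambda>h. f (t + h) \<le> f t + c' * h) (at_right 0)"
    using eventually_at_right_less[of 0] by eventually_elim (auto simp: field_simps)
  then show ?thesis
    by (simp add: eventually_at_right_to_0[of _ t] add.commute)
qed

text \<open>The function \<open>f\<close> is compared with a slightly larger solution \<open>w\<close> of \<open>w' > - \<alpha> w\<close>. At the last
time \<open>p\<close> at which \<open>f \<le> w\<close> holds, the bound on the upper right derivative forces \<open>f \<le> w\<close> to
persist beyond \<open>p\<close>, unless \<open>p\<close> is the end point.\<close>
lemma dini_decay:
  fixes f :: "real \<Rightarrow> real"
  assumes ut: "u \<le> t" and cont: "continuous_on {u..t} f"
    and dini: "\<And>v. u \<le> v \<Longrightarrow> v < t \<Longrightarrow> upper_right_deriv f v \<le> ereal (- \<alpha> * f v)"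
  shows "f t \<le> f u * exp (- \<alpha> * (t - u))"
proof (rule field_le_epsilon)
  fix e :: real assume e: "0 < e"
  define c where "c = \<bar>\<alpha>\<bar> + 1"
  define \<eta> where "\<eta> = e / exp (c * (t - u))"
  have \<eta>: "0 < \<eta>" using e by (simp add: \<eta>_def)
  \<comment> \<open>The growth rate \<open>c\<close> exceeds \<open>-\<alpha>\<close>, which makes the differential inequality for \<open>w\<close> strict.\<close>
  define w where "w v = f u * exp (- \<alpha> * (v - u)) + \<eta> * exp (c * (v - u))" for v
  define w' where "w' v = - \<alpha> * f u * exp (- \<alpha> * (v - u)) + c * \<eta> * exp (c * (v - u))" for v
  have w_deriv: "(w has_real_derivative w' v) (at v within S)" for v S
    unfolding w_def w'_def by (auto intro!: derivative_eq_intros simp: algebra_simps)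
  have w'_gt: "- \<alpha> * w v < w' v" for v
  proof -
    have "0 < (\<alpha> + c) * \<eta> * exp (c * (v - u))" using \<eta> by (auto simp: c_def)
    then show ?thesis by (simp add: w_def w'_def algebra_simps)
  qed
  define S where "S = {v \<in> {u..t}. f v \<le> w v}"
  have "closed S" unfolding S_def w_def
    by (intro continuous_on_closed_Collect_le cont continuous_intros)
  moreover have "u \<in> S" using ut \<eta> by (simp add: S_def w_def)
  moreover have bdd: "bdd_above S" by (rule bdd_aboveI[of _ t]) (auto simp: S_def)
  ultimately have p: "Sup S \<in> S" using closed_contains_Sup[of S] by blast
  define p where "p = Sup S"
  have p: "u \<le> p" "p \<le> t" "f p \<le> w p" using p by (auto simp: p_def S_def)
  have "p = t"
  proof (rule ccontr)
    assume "p \<noteq> t"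
    then have pt: "p < t" using p by simp
    have ev: "eventually (\<lambda>v. f v \<le> w v) (at_right p)"
    proof (cases "f p = w p")
      case True
      obtain c' where c': "- \<alpha> * f p < c'" "c' < w' p" using w'_gt[of p] True dense by metis
      have "((\<lambda>v. (w v - w p) / (v - p)) \<longlongrightarrow> w' p) (at_right p)"
        using w_deriv[of p "{p<..}"] by (simp add: has_field_derivative_iff)
      then have "eventually (\<lambda>v. c' < (w v - w p) / (v - p)) (at_right p)"
        using c'(2) by (rule order_tendstoD)
      then show ?thesis
        using upper_right_deriv_le[OF dini[OF p(1) pt] c'(1)] eventually_at_right_less[of p]
        by eventually_elim (use True in \<open>auto simp: field_simps\<close>)
    next
      case False
      then have "0 < w p - (f p + (- \<alpha> * f p + 1) * (p - p))" using p by simp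
      moreover have "((\<lambda>v. w v - (f p + (- \<alpha> * f p + 1) * (v - p))) \<longlongrightarrow>
          w p - (f p + (- \<alpha> * f p + 1) * (p - p))) (at_right p)"
        unfolding w_def by (intro tendsto_intros)
      ultimately have "eventually (\<lambda>v. 0 < w v - (f p + (- \<alpha> * f p + 1) * (v - p))) (at_right p)"
        by (rule order_tendstoD(1)[rotated])
      moreover have "eventually (\<lambda>v. f v \<le> f p + (- \<alpha> * f p + 1) * (v - p)) (at_right p)"
        by (rule upper_right_deriv_le[OF dini[OF p(1) pt]]) simp
      ultimately show ?thesis by eventually_elim linarith
    qed
    have "eventually (\<lambda>v. p < v \<and> v < t \<and> f v \<le> w v) (at_right p)"
      using ev eventually_at_right_less[of p] eventually_at_right_field[of "\<lambda>v. v < t" p] pt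
      by (auto intro: eventually_conj)
    then obtain v where v: "p < v" "v < t" "f v \<le> w v"
      using eventually_happens[of _ "at_right p"] trivial_limit_at_right_real by blast
    then have "v \<in> S" using p by (simp add: S_def)
    then have "v \<le> p" unfolding p_def using bdd by (rule cSup_upper)
    then show False using v by simp
  qed
  then show "f t \<le> f u * exp (- \<alpha> * (t - u)) + e"
    using p(3) by (simp add: w_def \<eta>_def)
qed

lemma upper_right_deriv_exp_decay:
  assumes "t < q" and le: "\<And>u. t < u \<Longrightarrow> u < q \<Longrightarrow> f u \<le> f t * exp (- \<alpha> * (u - t))"
  shows "upper_right_deriv f t \<le> ereal (- \<alpha> * f t)"
proof -
  have "((\<lambda>h. f t * exp (- \<alpha> * h)) has_real_derivative - \<alpha> * f t) (at 0)"
    by (auto intro!: derivative_eq_intros)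
  then have "((\<lambda>h. (f t * exp (- \<alpha> * h) - f t) / h) \<longlongrightarrow> - \<alpha> * f t) (at 0)"
    by (simp add: DERIV_def)
  then have "((\<lambda>h. (f t * exp (- \<alpha> * h) - f t) / h) \<longlongrightarrow> - \<alpha> * f t) (at_right 0)"
    by (rule tendsto_within_subset) simp
  then have lim: "((\<lambda>h. ereal ((f t * exp (- \<alpha> * h) - f t) / h)) \<longlongrightarrow> ereal (- \<alpha> * f t)) (at_right 0)"
    by (intro tendsto_intros)
  have "eventually (\<lambda>h. ereal ((f (t + h) - f t) / h) \<le> ereal ((f t * exp (- \<alpha> * h) - f t) / h)) (at_right 0)"
    unfolding eventually_at_right_field
  proof (intro exI conjI allI impI)
    show "0 < q - t" using assms by simp
    fix h assume "0 < h" "h < q - t"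
    then show "ereal ((f (t + h) - f t) / h) \<le> ereal ((f t * exp (- \<alpha> * h) - f t) / h)"
      using le[of "t + h"] by (simp add: divide_right_mono)
  qed
  then have "upper_right_deriv f t \<le> Limsup (at_right 0) (\<lambda>h. ereal ((f t * exp (- \<alpha> * h) - f t) / h))"
    unfolding upper_right_deriv_def by (rule Limsup_mono)
  also have "\<dots> = ereal (- \<alpha> * f t)"
    using lim by (intro lim_imp_Limsup) auto
  finally show ?thesis .
qed

text \<open>Decay from every interior point extends to the left end point. The majorant \<open>W\<close> is
there for the initial time: \<open>\<xi>\<close> may jump at it, so the value of \<open>f\<close> at that time does not control
the values directly afterwards.\<close>
lemma decay_from_right_limit:
  fixes f W :: "real \<Rightarrow> real"
  assumes "r < t" and decay: "\<And>u. r < u \<Longrightarrow> u < t \<Longrightarrow> f t \<le> f u * exp (- \<alpha> * (t - u))"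
    and le: "\<And>u. r < u \<Longrightarrow> u < t \<Longrightarrow> f u \<le> W u"
    and W: "(W \<longlongrightarrow> B) (at_right r)"
  shows "f t \<le> B * exp (- \<alpha> * (t - r))"
proof (rule tendsto_lowerbound)
  show "((\<lambda>u. W u * exp (- \<alpha> * (t - u))) \<longlongrightarrow> B * exp (- \<alpha> * (t - r))) (at_right r)"
    by (intro tendsto_intros W)
  have "f t \<le> W u * exp (- \<alpha> * (t - u))" if "r < u" "u < t" for u
    using decay[OF that] mult_right_mono[OF le[OF that], of "exp (- \<alpha> * (t - u))"]
    by (meson exp_ge_zero order_trans)
  then show "eventually (\<lambda>u. f t \<le> W u * exp (- \<alpha> * (t - u))) (at_right r)"
    using \<open>r < t\<close> by (auto simp: eventually_at_right_field)
qed simp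

section \<open>The largest componentwise ratio of two vectors\<close>

lemma tendsto_Max:
  fixes f :: "'i \<Rightarrow> 'a \<Rightarrow> real"
  assumes "finite I" "I \<noteq> {}" "\<And>i. i \<in> I \<Longrightarrow> (f i \<longlongrightarrow> l i) F"
  shows "((\<lambda>u. Max ((\<lambda>i. f i u) ` I)) \<longlongrightarrow> Max (l ` I)) F"
  using assms
proof (induction I rule: finite_ne_induct)
  case (insert i I)
  have "((\<lambda>u. max (f i u) (Max ((\<lambda>i. f i u) ` I))) \<longlongrightarrow> max (l i) (Max (l ` I))) F"
    using insert by (intro tendsto_max) auto
  then show ?case using insert by simp
qed simp

lemma infnorm_le_iff: "infnorm (x :: real ^ 'n) \<le> c \<longleftrightarrow> (\<forall>i. \<bar>x $ i\<bar> \<le> c)"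
proof
  assume "infnorm x \<le> c"
  then show "\<forall>i. \<bar>x $ i\<bar> \<le> c" using component_le_infnorm_cart order_trans by blast
next
  assume "\<forall>i. \<bar>x $ i\<bar> \<le> c"
  then show "infnorm x \<le> c" unfolding infnorm_cart by (intro cSup_least) auto
qed

definition max_ratio :: "real ^ 'n \<Rightarrow> real ^ 'n \<Rightarrow> real"
  where "max_ratio x \<xi> = Max (range (\<lambda>i. x $ i / \<xi> $ i))"

text \<open>All order arguments for the Lyapunov function use this characterisation: the ratio is the least
\<open>c\<close> with \<open>x \<le> c \<xi>\<close>.\<close>
lemma max_ratio_le_iff:
  assumes "\<And>i. 0 < \<xi> $ i"
  shows "max_ratio x \<xi> \<le> c \<longleftrightarrow> (\<forall>i. x $ i \<le> c * \<xi> $ i)"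
  using assms by (simp add: max_ratio_def pos_divide_le_eq)

lemma le_max_ratio_mult:
  assumes "\<And>i. 0 < \<xi> $ i"
  shows "x $ i \<le> max_ratio x \<xi> * \<xi> $ i"
  using max_ratio_le_iff[of \<xi> x "max_ratio x \<xi>"] assms by blast

lemma max_ratio_nonneg:
  assumes "\<And>i. 0 < \<xi> $ i" "0 \<le> x"
  shows "0 \<le> max_ratio x \<xi>"
proof -
  have "0 \<le> x $ undefined" using assms by (simp add: less_eq_vec_def)
  also have "\<dots> \<le> max_ratio x \<xi> * \<xi> $ undefined" by (rule le_max_ratio_mult[OF assms(1)])
  finally show ?thesis using assms(1)[of undefined] by (meson mult_neg_pos not_less)
qed

lemma tendsto_max_ratio:
  assumes "(x \<longlongrightarrow> x0) F" "(\<xi> \<longlongrightarrow> \<xi>0) F" "\<And>i. \<xi>0 $ i \<noteq> 0"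
  shows "((\<lambda>u. max_ratio (x u) (\<xi> u)) \<longlongrightarrow> max_ratio x0 \<xi>0) F"
  unfolding max_ratio_def
  by (rule tendsto_Max[where f = "\<lambda>i u. x u $ i / \<xi> u $ i" and l = "\<lambda>i. x0 $ i / \<xi>0 $ i"])
    (simp, simp, intro tendsto_divide tendsto_vec_nth assms)

section \<open>Induction along the impulse times\<close>

text \<open>The gaps may shrink to 0, so a time interval of given length may contain any number of impulses.
This is why the decay estimates count jumps as well as time.\<close>
locale impulse_times =
  fixes \<tau> :: "nat \<Rightarrow> real"
  assumes first_pos: "0 < \<tau> 1"
    and gap_pos: "\<And>k. 1 \<le> k \<Longrightarrow> \<tau> k < \<tau> (Suc k)"
    and tends_to_infinity: "filterlim \<tau> at_top sequentially"
begin

text \<open>A stretch from \<open>r\<close> to \<open>t\<close> during which at most one jump takes effect, the one at \<open>r\<close>. Since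
trajectories are left-continuous, the state at \<open>r\<close> is the one before that jump, and an impulse at
\<open>t\<close> acts only after the stretch.\<close>
definition segment :: "nat \<Rightarrow> real \<Rightarrow> real \<Rightarrow> bool"
  where "segment k r t \<longleftrightarrow> (0 < k \<longrightarrow> \<tau> k \<le> r) \<and> r < t \<and> t \<le> \<tau> (Suc k)"

lemma impulse_less: "1 \<le> j \<Longrightarrow> j < k \<Longrightarrow> \<tau> j < \<tau> k"
proof (induction k)
  case (Suc k)
  then show ?case using gap_pos[of k] by (cases "j = k") force+
qed simp

lemma impulse_le: "1 \<le> j \<Longrightarrow> j \<le> k \<Longrightarrow> \<tau> j \<le> \<tau> k"
  using impulse_less[of j k] by (cases "j = k") auto

lemma ex_impulse_greater: "\<exists>k. t < \<tau> (Suc k)"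
proof -
  have "eventually (\<lambda>k. t < \<tau> k) sequentially"
    using tends_to_infinity by (simp add: filterlim_at_top_dense)
  then obtain N where "\<And>k. N \<le> k \<Longrightarrow> t < \<tau> k" by (auto simp: eventually_sequentially)
  then have "t < \<tau> (Suc N)" by simp
  then show ?thesis ..
qed

lemma ex_segment:
  obtains k where "0 < k \<Longrightarrow> \<tau> k \<le> r" "r < \<tau> (Suc k)"
proof
  define k where "k = (LEAST k. r < \<tau> (Suc k))"
  show "r < \<tau> (Suc k)" unfolding k_def using ex_impulse_greater by (rule LeastI_ex)
  show "\<tau> k \<le> r" if k: "0 < k"
    using not_less_Least[of "k - 1" "\<lambda>k. r < \<tau> (Suc k)"] k
    unfolding k_def[symmetric] by auto
qed

lemma impulse_between:
  assumes "0 < k \<Longrightarrow> \<tau> k \<le> r" "r \<le> \<tau> j" "\<tau> j < \<tau> (Suc k)" "1 \<le> j"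
  shows "j = k \<and> \<tau> j = r"
proof -
  have "j \<le> k"
  proof (rule ccontr)
    assume "\<not> j \<le> k"
    then show False using impulse_le[of "Suc k" j] assms by auto
  qed
  moreover have "k \<le> j"
  proof (rule ccontr)
    assume "\<not> k \<le> j"
    then have "\<tau> j < \<tau> k" "0 < k" using impulse_less[of j k] assms by auto
    then show False using assms by force
  qed
  ultimately show ?thesis using assms by force
qed

lemma not_impulse_in_segment:
  "(0 < k \<Longrightarrow> \<tau> k \<le> r) \<Longrightarrow> r < u \<Longrightarrow> u < \<tau> (Suc k) \<Longrightarrow> u \<notin> \<tau> ` {1..}"
  using impulse_between[of k r] by force

lemma impulse_inject: "1 \<le> j \<Longrightarrow> 1 \<le> k \<Longrightarrow> \<tau> j = \<tau> k \<Longrightarrow> j = k"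
  using impulse_less[of j k] impulse_less[of k j] by (cases j k rule: linorder_cases) auto

text \<open>Every argument along a trajectory has this form: an invariant is carried from \<open>r\<close> to
\<open>t\<close> across at most one jump, the one at \<open>r\<close>, and one stretch of flow. The length of the stretch may be
restricted to any \<open>h > 0\<close>.\<close>
lemma segment_induct [consumes 2, case_names start short_step]:
  assumes "s \<le> t" "0 < h" and start: "P s"
    and short_step: "\<And>k r t. s \<le> r \<Longrightarrow> P r \<Longrightarrow> segment k r t \<Longrightarrow> t \<le> r + h \<Longrightarrow> P t"
  shows "P t"
proof -
  have steps: "P t" if "s \<le> r" "P r" "segment k r t" "t \<le> r + real n * h" for k r t n
    using that
  proof (induction n arbitrary: t)
    case 0
    then show ?case by (simp add: segment_def)
  next
    case (Suc n)
    show ?case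
    proof (cases "t \<le> r + real n * h")
      case True
      then show ?thesis using Suc by blast
    next
      case False
      define r' where "r' = r + real n * h"
      have r': "r \<le> r'" "r' < t" using False \<open>0 < h\<close> by (auto simp: r'_def)
      have "P r'"
      proof (cases "r' = r")
        case True
        then show ?thesis using Suc.prems by simp
      next
        case False
        then have "segment k r r'" using r' Suc.prems by (auto simp: segment_def)
        then show ?thesis using Suc.IH[of r'] Suc.prems by (simp add: r'_def)
      qed
      moreover have "segment k r' t" using r' Suc.prems by (auto simp: segment_def)
      moreover have "t \<le> r' + h" using Suc.prems by (simp add: r'_def algebra_simps)
      ultimately show ?thesis using short_step[of r' k t] r' Suc.prems by simp
    qed
  qed
  have piece: "P t" if "s \<le> r" "P r" "segment k r t" for k r t
  proof -
    obtain n where "(t - r) / h \<le> real n" using real_arch_simple by blast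
    then have "t \<le> r + real n * h" using \<open>0 < h\<close> by (simp add: field_simps)
    then show ?thesis using steps that by blast
  qed
  have upto: "\<forall>t. s \<le> t \<longrightarrow> t \<le> \<tau> (Suc k) \<longrightarrow> P t" for k
  proof (induction k)
    case 0
    show ?case
    proof (intro allI impI)
      fix t assume "s \<le> t" "t \<le> \<tau> (Suc 0)"
      then show "P t" using start piece[of s 0 t] by (cases "t = s") (auto simp: segment_def)
    qed
  next
    case (Suc k)
    show ?case
    proof (intro allI impI)
      fix t assume t: "s \<le> t" "t \<le> \<tau> (Suc (Suc k))"
      define r where "r = max s (\<tau> (Suc k))"
      show "P t"
      proof (cases "t \<le> r")
        case True
        then show ?thesis using Suc t start by (cases "t = s") (auto simp: r_def)
      next
        case False
        have "P r" using Suc start by (cases "s \<le> \<tau> (Suc k)") (auto simp: r_def max_def)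
        moreover have "segment (Suc k) r t" using t False by (auto simp: segment_def r_def not_le)
        moreover have "s \<le> r" by (simp add: r_def)
        ultimately show ?thesis using piece by blast
      qed
    qed
  qed
  obtain k where "t < \<tau> (Suc k)" using ex_impulse_greater by blast
  then show ?thesis using upto[of k] \<open>s \<le> t\<close> by auto
qed

lemma finite_jumps: "finite {k. 1 \<le> k \<and> s \<le> \<tau> k \<and> \<tau> k < t}"
proof -
  obtain N where N: "t < \<tau> (Suc N)" using ex_impulse_greater by blast
  have below: "k \<le> Suc N" if "1 \<le> k" "\<tau> k < t" for k
  proof (rule ccontr)
    assume "\<not> k \<le> Suc N"
    then show False using impulse_less[of "Suc N" k] N that by auto
  qed
  show ?thesis by (rule finite_subset[of _ "{..Suc N}"]) (use below in auto)
qed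

lemma num_jumps_split:
  assumes "s \<le> r" "r \<le> t"
  shows "num_jumps \<tau> t s = num_jumps \<tau> t r + num_jumps \<tau> r s"
proof -
  have "{k. 1 \<le> k \<and> s \<le> \<tau> k \<and> \<tau> k < t}
      = {k. 1 \<le> k \<and> r \<le> \<tau> k \<and> \<tau> k < t} \<union> {k. 1 \<le> k \<and> s \<le> \<tau> k \<and> \<tau> k < r}"
    using assms by auto
  moreover have "card ({k. 1 \<le> k \<and> r \<le> \<tau> k \<and> \<tau> k < t} \<union> {k. 1 \<le> k \<and> s \<le> \<tau> k \<and> \<tau> k < r})
      = card {k. 1 \<le> k \<and> r \<le> \<tau> k \<and> \<tau> k < t} + card {k. 1 \<le> k \<and> s \<le> \<tau> k \<and> \<tau> k < r}"
    by (rule card_Un_disjoint[OF finite_jumps finite_jumps]) auto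
  ultimately show ?thesis by (simp only: num_jumps_def)
qed

lemma num_jumps_self [simp]: "num_jumps \<tau> t t = 0"
proof -
  have none: "{k. 1 \<le> k \<and> t \<le> \<tau> k \<and> \<tau> k < t} = {}" by auto
  show ?thesis by (simp only: num_jumps_def none card.empty)
qed

lemma num_jumps_segment:
  assumes "segment k r t"
  shows "num_jumps \<tau> t r = (if r \<in> \<tau> ` {1..} then 1 else 0)"
proof -
  have eq: "{j. 1 \<le> j \<and> r \<le> \<tau> j \<and> \<tau> j < t} = {j. 1 \<le> j \<and> \<tau> j = r}"
  proof (intro Collect_cong iffI conjI)
    fix j assume "1 \<le> j \<and> r \<le> \<tau> j \<and> \<tau> j < t"
    then show "1 \<le> j" "\<tau> j = r" using impulse_between[of k r j] assms by (auto simp: segment_def)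
  qed (use assms in \<open>auto simp: segment_def\<close>)
  show ?thesis
  proof (cases "r \<in> \<tau> ` {1..}")
    case True
    then obtain i where "1 \<le> i" "\<tau> i = r" by auto
    then have "{j. 1 \<le> j \<and> \<tau> j = r} = {i}" using impulse_inject by auto
    then show ?thesis using True eq unfolding num_jumps_def by simp
  next
    case False
    then have none: "{j. 1 \<le> j \<and> \<tau> j = r} = {}" by auto
    show ?thesis using False by (simp only: num_jumps_def eq none card.empty if_False)
  qed
qed

lemma ex_flow_interval:
  assumes "s < r" "r \<notin> \<tau> ` {1..}"
  obtains k where "r \<in> flow_interval \<tau> s k" "r < \<tau> (Suc k)"
proof -
  obtain k where k: "0 < k \<Longrightarrow> \<tau> k \<le> r" "r < \<tau> (Suc k)" using ex_segment by blast
  have "\<tau> k < r" if "0 < k"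
    using k(1)[OF that] assms(2) that by (cases "\<tau> k = r") auto
  then have "r \<in> flow_interval \<tau> s k" using k(2) assms(1) by (simp add: flow_interval_def)
  then show ?thesis using that k(2) by blast
qed

lemma tendsto_at_right_flow_interval:
  assumes "continuous (at r within flow_interval \<tau> s k) x" "r \<in> flow_interval \<tau> s k" "r < \<tau> (Suc k)"
  shows "(x \<longlongrightarrow> x r) (at_right r)"
proof -
  have "(x \<longlongrightarrow> x r) (at r within {r<..\<tau> (Suc k)})"
    using assms(1) unfolding continuous_within
    by (rule tendsto_within_subset) (use assms(2) in \<open>auto simp: flow_interval_def\<close>)
  moreover have "at r within {r<..\<tau> (Suc k)} = at_right r"
    by (rule at_within_nhd[where S = "{..<\<tau> (Suc k)}"]) (use assms(3) in auto)
  ultimately show ?thesis by simp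
qed

lemma segment_subset_flow_interval: "segment k r t \<Longrightarrow> s \<le> r \<Longrightarrow> {r<..t} \<subseteq> flow_interval \<tau> s k"
  by (auto simp: segment_def flow_interval_def)

text \<open>Needed so that the derivative within a flow interval, which is one-sided at the right end, is
unique.\<close>
lemma flow_interval_nontrivial:
  assumes "t \<in> flow_interval \<tau> s k"
  shows "at t within flow_interval \<tau> s k \<noteq> bot"
proof -
  define l where "l = (if k = 0 then s else max s (\<tau> k))"
  have l: "l < t" "{l<..<t} \<subseteq> flow_interval \<tau> s k"
    using assms by (auto simp: l_def flow_interval_def split: if_splits)
  have "at_left t = at t within {l<..<t}"
    by (rule at_within_nhd[where S = "{l<..}"]) (use l in auto)
  also have "\<dots> \<le> at t within flow_interval \<tau> s k" using l by (intro at_le)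
  finally have le: "at_left t \<le> at t within flow_interval \<tau> s k" .
  show ?thesis
  proof
    assume "at t within flow_interval \<tau> s k = bot"
    then have "at_left t \<le> bot" using le by (simp only:)
    then have "at_left t = bot" by (rule le_bot)
    then show False using trivial_limit_at_left_real by blast
  qed
qed

lemma piecewise_C1_derivative:
  assumes "piecewise_C1 \<tau> s \<xi>" "t \<in> flow_interval \<tau> s k"
  shows "(\<xi> has_vector_derivative vector_derivative \<xi> (at t within flow_interval \<tau> s k))
    (at t within flow_interval \<tau> s k)"
  using assms by (simp add: piecewise_C1_def flip: vector_derivative_works)

lemma piecewise_C1_continuous_on:
  assumes "piecewise_C1 \<tau> s \<xi>"
  shows "continuous_on (flow_interval \<tau> s k) \<xi>"
  unfolding continuous_on_eq_continuous_within
  by (intro ballI has_vector_derivative_continuous[OF piecewise_C1_derivative[OF assms]])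

lemma piecewise_C1_right_limit:
  assumes "piecewise_C1 \<tau> s \<xi>" "1 \<le> k"
  shows "(\<xi> \<longlongrightarrow> right_lim \<xi> (\<tau> k)) (at_right (\<tau> k))"
proof -
  obtain l where l: "(\<xi> \<longlongrightarrow> l) (at_right (\<tau> k))" using assms unfolding piecewise_C1_def by blast
  then have "right_lim \<xi> (\<tau> k) = l" unfolding right_lim_def by (intro tendsto_Lim) auto
  then show ?thesis using l by simp
qed

lemma piecewise_C1_at_right:
  assumes "piecewise_C1 \<tau> s \<xi>" "s < r" "r \<notin> \<tau> ` {1..}"
  shows "(\<xi> \<longlongrightarrow> \<xi> r) (at_right r)"
proof -
  obtain k where "r \<in> flow_interval \<tau> s k" "r < \<tau> (Suc k)" using ex_flow_interval[OF assms(2,3)] .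
  then show ?thesis
    using tendsto_at_right_flow_interval has_vector_derivative_continuous
      piecewise_C1_derivative[OF assms(1)] by blast
qed

end

section \<open>Affine impulsive systems\<close>

locale impulsive_system = impulse_times \<tau> for \<tau> :: "nat \<Rightarrow> real" +
  fixes A :: "real \<Rightarrow> real ^ 'n ^ 'n" and J :: "nat \<Rightarrow> real ^ 'n ^ 'n" and a :: real
  assumes A_continuous: "continuous_on {0..} A"
    and A_bound: "0 \<le> t \<Longrightarrow> norm (A t *v v) \<le> a * norm v"
begin

lemma a_nonneg: "0 \<le> a"
  using order_trans[OF norm_ge_zero A_bound[of 0 "axis undefined 1"]] by simp

text \<open>With the identity as jump map away from the impulses, solutions obey the single condition
\<open>x(r\<^sup>+) = jump d r (x r)\<close> at every time \<open>r\<close>, whether or not \<open>r\<close> is an impulse.\<close>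
definition jump :: "real ^ 'n \<Rightarrow> real \<Rightarrow> real ^ 'n \<Rightarrow> real ^ 'n"
  where "jump d r v = (if r \<in> \<tau> ` {1..} then J (inv_into {1..} \<tau> r) *v v + d else v)"

lemma jump_at_impulse: "1 \<le> k \<Longrightarrow> jump d (\<tau> k) v = J k *v v + d"
proof -
  assume k: "1 \<le> k"
  have "inj_on \<tau> {1..}" using impulse_inject by (auto simp: inj_on_def)
  then show ?thesis using k by (auto simp: jump_def inv_into_f_f)
qed

lemma jump_elsewhere: "r \<notin> \<tau> ` {1..} \<Longrightarrow> jump d r v = v"
  by (simp add: jump_def)

lemma jump_diff: "jump d r v - jump d' r v' = jump (d - d') r (v - v')"
  by (simp add: jump_def matrix_vector_mult_diff_distrib)

lemma jump_zero [simp]: "jump 0 r 0 = 0"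
  by (simp add: jump_def)

text \<open>The forcing \<open>b\<close> acts during flows and \<open>d\<close> at jumps; \<open>b = d = 0\<close> is the system itself, by
\<open>solution_from_iff\<close>.\<close>
definition impulsive_solution :: "real ^ 'n \<Rightarrow> real ^ 'n \<Rightarrow> real \<Rightarrow> (real \<Rightarrow> real ^ 'n) \<Rightarrow> bool"
  where "impulsive_solution b d s x \<longleftrightarrow>
    (\<forall>k. \<forall>t\<in>flow_interval \<tau> s k.
        (x has_vector_derivative A t *v x t + b) (at t within flow_interval \<tau> s k)) \<and>
    (\<forall>r\<ge>s. (x \<longlongrightarrow> jump d r (x r)) (at_right r))"

lemma impulsive_solution_derivative:
  "impulsive_solution b d s x \<Longrightarrow> t \<in> flow_interval \<tau> s k \<Longrightarrow>
    (x has_vector_derivative A t *v x t + b) (at t within flow_interval \<tau> s k)"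
  by (simp add: impulsive_solution_def)

lemma impulsive_solution_at_right:
  "impulsive_solution b d s x \<Longrightarrow> s \<le> r \<Longrightarrow> (x \<longlongrightarrow> jump d r (x r)) (at_right r)"
  by (simp add: impulsive_solution_def)

lemma impulsive_solution_flow:
  assumes "impulsive_solution b d s x" "segment k r t" "s \<le> r" "u \<in> {r<..t}"
  shows "(x has_vector_derivative A u *v x u + b) (at u within {r<..t})"
proof (rule has_vector_derivative_within_subset)
  show "{r<..t} \<subseteq> flow_interval \<tau> s k" using assms segment_subset_flow_interval by auto
  then show "(x has_vector_derivative A u *v x u + b) (at u within flow_interval \<tau> s k)"
    using assms by (auto simp: impulsive_solution_def)
qed

lemma solution_from_iff:
  assumes s: "0 \<le> s"
  shows "solution_from A J \<tau> s x \<longleftrightarrow> impulsive_solution 0 0 s x"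
proof
  assume sol: "solution_from A J \<tau> s x"
  have "(x \<longlongrightarrow> jump 0 r (x r)) (at_right r)" if r: "s \<le> r" for r
  proof (cases "r \<in> \<tau> ` {1..}")
    case True
    then show ?thesis using sol r by (auto simp: solution_from_def jump_at_impulse)
  next
    case False
    show ?thesis
    proof (cases "r = s")
      case True
      then show ?thesis using sol False by (auto simp: solution_from_def jump_elsewhere)
    next
      case neq: False
      obtain k where k: "r \<in> flow_interval \<tau> s k" "r < \<tau> (Suc k)"
        using ex_flow_interval[of s r] r neq False by auto
      then have "(x has_vector_derivative A r *v x r) (at r within flow_interval \<tau> s k)"
        using sol by (simp add: solution_from_def)
      then have "(x \<longlongrightarrow> x r) (at_right r)"
        using tendsto_at_right_flow_interval[OF has_vector_derivative_continuous k] by blast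
      then show ?thesis using False by (simp add: jump_elsewhere)
    qed
  qed
  then show "impulsive_solution 0 0 s x"
    using sol by (auto simp: solution_from_def impulsive_solution_def)
next
  assume sol: "impulsive_solution 0 0 s x"
  have "(x \<longlongrightarrow> J k *v x (\<tau> k)) (at_right (\<tau> k))" if "1 \<le> k" "s \<le> \<tau> k" for k
    using impulsive_solution_at_right[OF sol that(2)] that by (simp add: jump_at_impulse)
  moreover have "(x \<longlongrightarrow> x s) (at_right s)" if "s \<notin> \<tau> ` {1..}"
    using impulsive_solution_at_right[OF sol, of s] that by (simp add: jump_elsewhere)
  ultimately show "solution_from A J \<tau> s x"
    using sol by (auto simp: solution_from_def impulsive_solution_def)
qed

lemma impulsive_solution_later:
  assumes "impulsive_solution b d s x" "s \<le> r"
  shows "impulsive_solution b d r x"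
proof -
  have sub: "flow_interval \<tau> r k \<subseteq> flow_interval \<tau> s k" for k
    using assms(2) by (auto simp: flow_interval_def)
  have "(x has_vector_derivative A t *v x t + b) (at t within flow_interval \<tau> r k)"
    if "t \<in> flow_interval \<tau> r k" for t k
  proof (rule has_vector_derivative_within_subset[OF _ sub])
    show "(x has_vector_derivative A t *v x t + b) (at t within flow_interval \<tau> s k)"
      using assms(1) sub that by (auto simp: impulsive_solution_def)
  qed
  then show ?thesis using assms by (auto simp: impulsive_solution_def)
qed

lemma impulsive_solution_diff:
  assumes "impulsive_solution b d s x" "impulsive_solution b' d' s y"
  shows "impulsive_solution (b - b') (d - d') s (\<lambda>t. x t - y t)"
proof -
  have "((\<lambda>t. x t - y t) has_vector_derivative A t *v (x t - y t) + (b - b'))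
      (at t within flow_interval \<tau> s k)" if "t \<in> flow_interval \<tau> s k" for t k
    using has_vector_derivative_diff[OF impulsive_solution_derivative[OF assms(1) that]
        impulsive_solution_derivative[OF assms(2) that]]
    by (simp add: matrix_vector_mult_diff_distrib algebra_simps)
  moreover have "((\<lambda>t. x t - y t) \<longlongrightarrow> jump (d - d') r (x r - y r)) (at_right r)" if "s \<le> r" for r
    using tendsto_diff[OF impulsive_solution_at_right[OF assms(1) that]
        impulsive_solution_at_right[OF assms(2) that]] by (simp add: jump_diff)
  ultimately show ?thesis by (simp add: impulsive_solution_def)
qed

lemma impulsive_solution_scaleR:
  assumes "impulsive_solution 0 0 s x"
  shows "impulsive_solution 0 0 s (\<lambda>t. c *\<^sub>R x t)"
proof -
  have "((\<lambda>t. c *\<^sub>R x t) has_vector_derivative A t *v (c *\<^sub>R x t))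
      (at t within flow_interval \<tau> s k)" if "t \<in> flow_interval \<tau> s k" for t k
    using bounded_linear.has_vector_derivative[OF bounded_linear_scaleR_right
        impulsive_solution_derivative[OF assms that], of c]
    by (simp add: matrix_vector_mult_scaleR)
  moreover have "((\<lambda>t. c *\<^sub>R x t) \<longlongrightarrow> jump 0 r (c *\<^sub>R x r)) (at_right r)" if "s \<le> r" for r
    using tendsto_scaleR[OF tendsto_const impulsive_solution_at_right[OF assms that], of c]
    by (auto simp: jump_def matrix_vector_mult_scaleR)
  ultimately show ?thesis by (simp add: impulsive_solution_def)
qed

lemma impulsive_solution_add:
  assumes "impulsive_solution 0 0 s x" "impulsive_solution 0 0 s y"
  shows "impulsive_solution 0 0 s (\<lambda>t. x t + y t)"
  using impulsive_solution_diff[OF assms(1) impulsive_solution_scaleR[OF assms(2), of "-1"]] by simp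

lemma impulsive_solution_zero: "impulsive_solution 0 0 s (\<lambda>t. 0)"
  by (simp add: impulsive_solution_def)

lemma impulsive_solution_sum:
  assumes "finite I" "\<And>i. i \<in> I \<Longrightarrow> impulsive_solution 0 0 s (x i)"
  shows "impulsive_solution 0 0 s (\<lambda>t. \<Sum>i\<in>I. x i t)"
  using assms by (induction I rule: finite_induct) (auto simp: impulsive_solution_zero impulsive_solution_add)

lemma impulsive_solution_unique:
  assumes "0 \<le> s" "impulsive_solution b d s x" "impulsive_solution b d s y" "x s = y s" "s \<le> t"
  shows "x t = y t"
proof -
  define z where "z t = x t - y t" for t
  have z: "impulsive_solution 0 0 s z"
    using impulsive_solution_diff[OF assms(2,3)] by (simp add: z_def[abs_def])
  have "z t = 0"
    using \<open>s \<le> t\<close> zero_less_one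
  proof (induction rule: segment_induct)
    case start
    then show ?case using assms by (simp add: z_def)
  next
    case (short_step k r t)
    have "norm (z t) \<le> (norm (0 :: real ^ 'n) + norm (0 :: real ^ 'n)) * exp ((a + 1) * (t - r))"
    proof (rule affine_flow_growth)
      show "r < t" using short_step by (simp add: segment_def)
      show "(z has_vector_derivative A u *v z u + 0) (at u within {r<..t})" if "u \<in> {r<..t}" for u
        using impulsive_solution_flow[OF z] short_step that by blast
      show "norm (A u *v v) \<le> a * norm v" if "u \<in> {r<..t}" for u v
        using A_bound[of u v] that short_step assms(1) by auto
      show "(z \<longlongrightarrow> 0) (at_right r)"
        using impulsive_solution_at_right[OF z \<open>s \<le> r\<close>] short_step by simp
    qed
    then show ?case by simp
  qed
  then show ?thesis by (simp add: z_def)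
qed

lemma flow_exists:
  assumes "0 \<le> r"
  shows "\<exists>y. y r = y0 \<and> (\<forall>t\<ge>r. (y has_vector_derivative A t *v y t + b) (at t within {r..}))"
proof (rule global_picard_lindeloef[of r "\<lambda>t v. A t *v v + b" a "norm b" y0])
  have A_cont: "continuous_on {r..} A"
    by (rule continuous_on_subset[OF A_continuous]) (use assms in auto)
  have entry_cont: "continuous_on {r..} (\<lambda>t. A t $ i $ j)" for i j
    by (intro continuous_on_component A_cont)
  show "continuous_on {r..} (\<lambda>t. A t *v z t + b)" if "continuous_on {r..} z" for z :: "real \<Rightarrow> real ^ 'n"
    unfolding matrix_vector_mult_def
    by (intro continuous_intros continuous_on_vec_lambda entry_cont continuous_on_component that)
  show "norm ((A t *v u + b) - (A t *v v + b)) \<le> a * norm (u - v)" if "r \<le> t" for t u v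
    using A_bound[of t "u - v"] that assms by (simp add: matrix_vector_mult_diff_distrib)
qed (use a_nonneg in auto)

definition flow :: "real ^ 'n \<Rightarrow> real \<Rightarrow> real ^ 'n \<Rightarrow> real \<Rightarrow> real ^ 'n"
  where "flow b r y0 = (SOME y. y r = y0 \<and>
    (\<forall>t\<ge>r. (y has_vector_derivative A t *v y t + b) (at t within {r..})))"

lemma flow:
  assumes "0 \<le> r"
  shows flow_start: "flow b r y0 r = y0"
    and flow_derivative: "r \<le> t \<Longrightarrow> (flow b r y0 has_vector_derivative A t *v flow b r y0 t + b) (at t within {r..})"
  using someI_ex[OF flow_exists[OF assms, of y0 b]] unfolding flow_def[symmetric] by auto

lemma flow_at_right:
  assumes "0 \<le> r" "r \<le> q"
  shows "(flow b r y0 \<longlongrightarrow> flow b r y0 q) (at_right q)"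
proof -
  have "(flow b r y0 \<longlongrightarrow> flow b r y0 q) (at q within {r..})"
    using has_vector_derivative_continuous[OF flow_derivative[OF assms]] by (simp add: continuous_within)
  then show ?thesis by (rule tendsto_within_subset) (use assms in auto)
qed

text \<open>Stage \<open>k\<close> is correct up to time \<open>\<tau> (Suc k)\<close>. Impulses before the starting time \<open>s\<close> are handled by
restarting at \<open>s\<close> itself, where all earlier stages have the value \<open>x0\<close>.\<close>
primrec pieces :: "real ^ 'n \<Rightarrow> real ^ 'n \<Rightarrow> real \<Rightarrow> real ^ 'n \<Rightarrow> nat \<Rightarrow> real \<Rightarrow> real ^ 'n" where
  "pieces b d s x0 0 = (\<lambda>t. if t \<le> s then x0 else flow b s (jump d s x0) t)"
| "pieces b d s x0 (Suc k) = (\<lambda>t. let r = max s (\<tau> (Suc k)) in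
     if t \<le> r then pieces b d s x0 k t else flow b r (jump d r (pieces b d s x0 k r)) t)"

text \<open>Each stage agrees with all later ones up to its next impulse, so the stages define a common
limit, which solves the equation on every flow interval.\<close>
lemma impulsive_solution_exists:
  assumes s: "0 \<le> s"
  obtains x where "impulsive_solution b d s x" "x s = x0"
proof
  define X where "X = pieces b d s x0"
  define start where "start k = (if k = 0 then s else max s (\<tau> k))" for k
  have s_start: "s \<le> start k" for k by (simp add: start_def)
  have stable_Suc: "X (Suc k) t = X k t" if "t \<le> start (Suc k)" for k t
    using that by (simp add: X_def start_def)
  have start_mono: "start j \<le> start k" if "j \<le> k" for j k
    using that impulse_le[of j k] by (cases j) (auto simp: start_def le_max_iff_disj)
  have stable: "X k t = X j t" if "j \<le> k" "t \<le> start (Suc j)" for j k t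
    using \<open>j \<le> k\<close>
  proof (induction k rule: dec_induct)
    case (step k)
    then show ?case using stable_Suc[of t k] start_mono[of "Suc j" "Suc k"] that by simp
  qed simp
  have X_start: "X k t = x0" if "t \<le> s" for k t
    using stable[of 0 k t] that s_start[of 1] by (simp add: X_def)
  define x where "x t = X (LEAST k. t \<le> \<tau> (Suc k)) t" for t
  have x_eq: "x t = X k t" if "t \<le> \<tau> (Suc k)" for k t
  proof -
    let ?j = "LEAST k. t \<le> \<tau> (Suc k)"
    have "t \<le> \<tau> (Suc ?j)" "?j \<le> k"
      using that by (rule LeastI, rule Least_le)
    moreover from this have "t \<le> start (Suc ?j)" by (simp add: start_def)
    ultimately show ?thesis using stable[of ?j k t] by (simp add: x_def)
  qed
  have x_start: "x t = x0" if "t \<le> s" for t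
    unfolding x_def using X_start that by blast
  have flow_eq: "x t = flow b (start k) (jump d (start k) (x (start k))) t"
    if "start k < t" "t \<le> \<tau> (Suc k)" for k t
  proof (cases k)
    case 0
    then show ?thesis using that x_eq[of t 0] x_start[of s] by (simp add: X_def start_def)
  next
    case (Suc j)
    have "x (start k) = X j (start k)"
    proof (cases "s \<le> \<tau> k")
      case True
      then show ?thesis using x_eq[of "start k" j] Suc by (simp add: start_def max_def)
    next
      case False
      then show ?thesis using x_start X_start Suc by (simp add: start_def max_def)
    qed
    moreover have "\<not> t \<le> max s (\<tau> (Suc j))" using that Suc by (auto simp: start_def not_le)
    ultimately show ?thesis using that x_eq[of t k] Suc by (simp add: X_def start_def Let_def)
  qed
  have start_nonneg: "0 \<le> start k" for k using s s_start[of k] by linarith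
  have "(x has_vector_derivative A t *v x t + b) (at t within flow_interval \<tau> s k)"
    if t: "t \<in> flow_interval \<tau> s k" for k t
  proof -
    have interval: "flow_interval \<tau> s k = {start k<..\<tau> (Suc k)}"
      by (auto simp: flow_interval_def start_def)
    let ?y = "flow b (start k) (jump d (start k) (x (start k)))"
    have "(?y has_vector_derivative A t *v ?y t + b) (at t within flow_interval \<tau> s k)"
      by (rule has_vector_derivative_within_subset[OF flow_derivative[OF start_nonneg]])
         (use t interval in auto)
    then have "(?y has_vector_derivative A t *v x t + b) (at t within flow_interval \<tau> s k)"
      using flow_eq[of k t] t interval by simp
    then show ?thesis
      by (rule has_vector_derivative_transform[rotated 2]) (use t interval flow_eq in auto)
  qed
  moreover have "(x \<longlongrightarrow> jump d r (x r)) (at_right r)" if r: "s \<le> r" for r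
  proof -
    obtain k where k: "0 < k \<Longrightarrow> \<tau> k \<le> r" "r < \<tau> (Suc k)" using ex_segment by blast
    have start_r: "start k \<le> r" using k r by (simp add: start_def)
    let ?y = "flow b (start k) (jump d (start k) (x (start k)))"
    have "?y r = jump d r (x r)"
    proof (cases "start k = r")
      case True
      then show ?thesis using flow_start[OF start_nonneg[of k]] by simp
    next
      case False
      then have less: "start k < r" using start_r by simp
      then have "r \<notin> \<tau> ` {1..}"
        using k by (intro not_impulse_in_segment[of k "start k"]) (auto simp: start_def)
      then show ?thesis using flow_eq[of k r] less k by (simp add: jump_elsewhere)
    qed
    then have "(?y \<longlongrightarrow> jump d r (x r)) (at_right r)"
      using flow_at_right[OF start_nonneg start_r] by metis
    moreover have "eventually (\<lambda>t. ?y t = x t) (at_right r)"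
      unfolding eventually_at_right_field using k(2) start_r flow_eq[of k] by (intro exI[of _ "\<tau> (Suc k)"]) auto
    ultimately show ?thesis by (rule Lim_transform_eventually)
  qed
  ultimately show "impulsive_solution b d s x" by (simp add: impulsive_solution_def)
  show "x s = x0" using x_start by simp
qed

text \<open>The columns are the solutions that start at the unit vectors.\<close>
lemma state_transition_matrix_exists: "\<exists>\<Phi>. state_transition_matrix A J \<tau> \<Phi>"
proof -
  have "\<exists>x. impulsive_solution 0 0 s x \<and> x s = axis j 1" if "0 \<le> s" for s and j :: 'n
    using impulsive_solution_exists[OF that, of 0 0 "axis j 1"] by blast
  then obtain X where X: "\<And>s j. 0 \<le> s \<Longrightarrow> impulsive_solution 0 0 s (X s j) \<and> X s j s = axis j 1"
    by metis
  define \<Phi> where "\<Phi> t s = (\<chi> i j. X s j t $ i)" for t s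
  have \<Phi>_mult: "\<Phi> t s *v v = (\<Sum>j\<in>UNIV. v $ j *\<^sub>R X s j t)" for t s v
    by (simp add: vec_eq_iff \<Phi>_def matrix_vector_mult_def mult.commute)
  have "\<Phi> s s = mat 1" if "0 \<le> s" for s
    using X[OF that] by (simp add: vec_eq_iff \<Phi>_def mat_def axis_def)
  moreover have "solution_from A J \<tau> s (\<lambda>t. \<Phi> t s *v v)" if "0 \<le> s" for s v
    unfolding \<Phi>_mult solution_from_iff[OF that]
    using X[OF that] by (intro impulsive_solution_sum impulsive_solution_scaleR) auto
  ultimately show ?thesis by (auto simp: state_transition_matrix_def)
qed

lemma state_transition_matrix_solution:
  assumes "state_transition_matrix A J \<tau> \<Phi>" "0 \<le> s" "impulsive_solution 0 0 s x" "s \<le> t"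
  shows "x t = \<Phi> t s *v x s"
proof (rule impulsive_solution_unique[OF assms(2,3)])
  show "impulsive_solution 0 0 s (\<lambda>t. \<Phi> t s *v x s)"
    using assms by (simp add: state_transition_matrix_def flip: solution_from_iff)
qed (use assms in \<open>auto simp: state_transition_matrix_def\<close>)

lemma impulsive_solution_growth:
  assumes "0 \<le> s" "impulsive_solution b d s x" "segment k r t" "s \<le> r"
  shows "norm (x t) \<le> (norm (jump d r (x r)) + norm b) * exp ((a + 1) * (t - r))"
proof (rule affine_flow_growth)
  show "r < t" using assms by (simp add: segment_def)
  show "(x has_vector_derivative A u *v x u + b) (at u within {r<..t})" if "u \<in> {r<..t}" for u
    using impulsive_solution_flow assms that by blast
  show "norm (A u *v v) \<le> a * norm v" if "u \<in> {r<..t}" for u v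
    using A_bound[of u v] that assms by auto
  show "(x \<longlongrightarrow> jump d r (x r)) (at_right r)"
    using impulsive_solution_at_right assms by blast
qed

lemma impulsive_solution_deviation:
  assumes "0 \<le> s" "impulsive_solution b d s x" "segment k r t" "s \<le> r"
  shows "norm (x t - jump d r (x r))
    \<le> (a * ((norm (jump d r (x r)) + norm b) * exp ((a + 1) * (t - r))) + norm b) * (t - r)"
proof (rule affine_flow_deviation)
  show "r < t" using assms by (simp add: segment_def)
  show "(x has_vector_derivative A u *v x u + b) (at u within {r<..t})" if "u \<in> {r<..t}" for u
    using impulsive_solution_flow assms that by blast
  show "norm (A u *v v) \<le> a * norm v" if "u \<in> {r<..t}" for u v
    using A_bound[of u v] that assms by auto
  show "(x \<longlongrightarrow> jump d r (x r)) (at_right r)"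
    using impulsive_solution_at_right assms by blast
qed

end

section \<open>Positive impulsive systems\<close>

locale positive_impulsive_system = impulsive_system \<tau> A J a
  for \<tau> :: "nat \<Rightarrow> real" and A :: "real \<Rightarrow> real ^ 'n ^ 'n" and J and a +
  assumes A_metzler: "0 \<le> t \<Longrightarrow> metzler (A t)"
    and J_nonneg: "1 \<le> k \<Longrightarrow> nonneg_mat (J k)"
begin

lemma nonneg_mat_mult: "nonneg_mat M \<Longrightarrow> 0 \<le> v \<Longrightarrow> 0 \<le> M *v v"
  by (auto simp: nonneg_mat_def less_eq_vec_def matrix_vector_mult_def intro!: sum_nonneg)

lemma jump_nonneg: "0 \<le> d \<Longrightarrow> 0 \<le> v \<Longrightarrow> 0 \<le> jump d r v"
  using nonneg_mat_mult[OF J_nonneg, of "inv_into {1..} \<tau> r" v] inv_into_into[of r \<tau> "{1..}"]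
  by (auto simp: jump_def)

text \<open>Applied to \<open>y = z - x\<close>, this compares a solution \<open>x\<close> with a supersolution \<open>z\<close>.\<close>
lemma segment_comparison:
  assumes "0 \<le> r" "segment k r t"
    and "\<And>u. u \<in> {r<..t} \<Longrightarrow> (y has_vector_derivative y' u) (at u within {r<..t})"
    and "\<And>u. u \<in> {r<..t} \<Longrightarrow> A u *v y u \<le> y' u"
    and "(y \<longlongrightarrow> y0) (at_right r)" "0 \<le> y0"
  shows "0 \<le> y t"
proof (rule metzler_flow_nonneg)
  show "r < t" using assms by (simp add: segment_def)
  show "norm (A u *v v) \<le> a * norm v" if "u \<in> {r<..t}" for u v
    using A_bound[of u v] that assms by auto
qed (use assms A_metzler in auto)

lemma impulsive_solution_nonneg:
  assumes "0 \<le> s" "impulsive_solution b d s x" "0 \<le> b" "0 \<le> d" "0 \<le> x s" "s \<le> t"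
  shows "0 \<le> x t"
  using \<open>s \<le> t\<close> zero_less_one
proof (induction rule: segment_induct)
  case (short_step k r t)
  show ?case
  proof (rule segment_comparison[OF _ \<open>segment k r t\<close>])
    show "(x has_vector_derivative A u *v x u + b) (at u within {r<..t})" if "u \<in> {r<..t}" for u
      using impulsive_solution_flow assms short_step that by blast
    show "(x \<longlongrightarrow> jump d r (x r)) (at_right r)"
      using impulsive_solution_at_right assms short_step by blast
    show "0 \<le> jump d r (x r)" using jump_nonneg assms short_step by blast
  qed (use assms short_step in auto)
qed (use assms in auto)

end

section \<open>From stability to a strict supersolution\<close>

context impulsive_system
begin

text \<open>The invariant says that the homogeneous trajectory through the state \<open>\<xi> t\<close> stays below
\<open>K * q u t\<close> at all later times \<open>u\<close>. It is a bound on \<open>\<xi> t\<close> in a time-dependent norm in which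
the system contracts strictly. Over a step from \<open>r\<close> to \<open>t\<close> the state splits into the
homogeneous continuation of \<open>\<xi> r\<close>, which has contracted, and a part \<open>p\<close> that starts at 0
and collects the forcing. For \<open>K\<close> large enough the first gains more than the second costs.\<close>
lemma affine_solution_bounded:
  assumes \<Phi>: "state_transition_matrix A J \<tau> \<Phi>"
    and bound: "\<And>s t v. 0 \<le> s \<Longrightarrow> s \<le> t \<Longrightarrow>
      norm (\<Phi> t s *v v) \<le> M * \<rho> ^ num_jumps \<tau> t s * exp (- \<alpha> * (t - s)) * norm v"
    and M: "0 < M" and \<rho>: "0 < \<rho>" "\<rho> < 1" and \<alpha>: "0 < \<alpha>"
    and \<xi>: "impulsive_solution b d 0 \<xi>"
  obtains K where "\<And>t. 0 \<le> t \<Longrightarrow> norm (\<xi> t) \<le> K"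
proof -
  \<comment> \<open>Steps with \<open>\<alpha> * h \<le> 1\<close> admit the linear bound \<open>exp (- y) \<le> 1 - y / 2\<close>.\<close>
  define h where "h = min 1 (1 / \<alpha>)"
  have "0 < h" using \<alpha> by (simp add: h_def)
  define C where "C = a * (norm b * exp (a + 1)) + norm b"
  define D where "D = (norm d + norm b) * exp (a + 1)"
  \<comment> \<open>The three entries meet the initial condition, the forcing during a flow step, and the forcing at a jump.\<close>
  define K where "K = max (M * norm (\<xi> 0)) (max (2 * M * C / \<alpha>) (M * D / (1 - \<rho>)))"
  have "0 \<le> C" "0 \<le> D" using a_nonneg by (auto simp: C_def D_def)
  have K_init: "M * norm (\<xi> 0) \<le> K" by (simp add: K_def)
  then have K0: "0 \<le> K" using M by (meson less_imp_le mult_nonneg_nonneg norm_ge_zero order_trans)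
  have "2 * M * C / \<alpha> \<le> K" "M * D / (1 - \<rho>) \<le> K" by (auto simp: K_def)
  then have K_flow: "2 * (M * C) \<le> K * \<alpha>" and K_jump: "M * D \<le> K * (1 - \<rho>)"
    using \<alpha> \<rho> by (auto simp: pos_divide_le_eq mult.assoc)
  define q where "q u t = \<rho> ^ num_jumps \<tau> u t * exp (- \<alpha> * (u - t))" for u t
  have q_pos: "0 < q u t" for u t using \<rho> by (simp add: q_def)
  have q_split: "q u r = q u t * q t r" if "r \<le> t" "t \<le> u" for u t r
    using num_jumps_split[OF that] by (simp add: q_def power_add algebra_simps flip: exp_add)
  have "\<forall>u\<ge>t. norm (\<Phi> u t *v \<xi> t) \<le> K * q u t" if "0 \<le> t" for t
    using that \<open>0 < h\<close>
  proof (induction rule: segment_induct)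
    case start
    show ?case
    proof (intro allI impI)
      fix u :: real assume u: "0 \<le> u"
      have "norm (\<Phi> u 0 *v \<xi> 0) \<le> (M * norm (\<xi> 0)) * q u 0"
        using bound[of 0 u "\<xi> 0"] u by (simp add: q_def algebra_simps)
      also have "\<dots> \<le> K * q u 0" using K_init q_pos[of u 0] by (intro mult_right_mono) auto
      finally show "norm (\<Phi> u 0 *v \<xi> 0) \<le> K * q u 0" .
    qed
  next
    case (short_step k r t)
    have rt: "r < t" using short_step by (simp add: segment_def)
    define p where "p t = \<xi> t - \<Phi> t r *v \<xi> r" for t
    have homogeneous: "impulsive_solution 0 0 r (\<lambda>t. \<Phi> t r *v \<xi> r)"
      using \<Phi> short_step by (simp add: state_transition_matrix_def flip: solution_from_iff)
    have p: "impulsive_solution b d r p"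
      using impulsive_solution_diff[OF impulsive_solution_later[OF \<xi> \<open>0 \<le> r\<close>] homogeneous]
      by (simp add: p_def[abs_def])
    have p_start: "p r = 0" using \<Phi> short_step by (simp add: p_def state_transition_matrix_def)
    have exp_le: "exp ((a + 1) * (t - r)) \<le> exp (a + 1)"
      using short_step a_nonneg rt by (auto simp: h_def intro!: mult_left_le)
    have key: "K * q t r + M * norm (p t) \<le> K"
    proof (cases "r \<in> \<tau> ` {1..}")
      case True
      then have "jump d r (p r) = d" by (simp add: jump_def p_start)
      then have "norm (p t) \<le> (norm d + norm b) * exp ((a + 1) * (t - r))"
        using impulsive_solution_growth[OF \<open>0 \<le> r\<close> p \<open>segment k r t\<close>] by simp
      also have "\<dots> \<le> D" unfolding D_def using exp_le by (intro mult_left_mono) auto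
      finally have "M * norm (p t) \<le> K * (1 - \<rho>)"
        using K_jump M mult_left_mono[of "norm (p t)" D M] by linarith
      moreover have "K * q t r \<le> K * \<rho>"
        using num_jumps_segment[OF \<open>segment k r t\<close>] True K0 \<rho> \<alpha> rt
        by (intro mult_left_mono) (auto simp: q_def mult_left_le)
      ultimately show ?thesis by (simp add: algebra_simps)
    next
      case False
      define x where "x = t - r"
      have "0 < x" "x \<le> 1" "x \<le> 1 / \<alpha>"
        using rt short_step by (auto simp: x_def h_def)
      then have x: "0 < x" "x \<le> 1" "\<alpha> * x \<le> 1"
        using \<alpha> by (auto simp: pos_le_divide_eq mult.commute)
      have "jump d r (p r) = 0" using False by (simp add: jump_def p_start)
      then have "norm (p t) \<le> (a * (norm b * exp ((a + 1) * (t - r))) + norm b) * x"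
        using impulsive_solution_deviation[OF \<open>0 \<le> r\<close> p \<open>segment k r t\<close>] by (simp add: x_def)
      also have "\<dots> \<le> C * x"
        unfolding C_def using exp_le a_nonneg x by (intro mult_right_mono add_mono mult_left_mono) auto
      finally have "2 * (M * norm (p t)) \<le> 2 * (M * (C * x))" using M by simp
      also have "\<dots> = (2 * (M * C)) * x" by simp
      also have "\<dots> \<le> (K * \<alpha>) * x" using K_flow x by (intro mult_right_mono) auto
      finally have "M * norm (p t) \<le> K * (\<alpha> * x / 2)" by simp
      moreover have "exp (- (\<alpha> * x)) \<le> 1 - \<alpha> * x / 2"
      proof -
        have "1 \<le> (1 + \<alpha> * x) * (1 - \<alpha> * x / 2)"
          using mult_left_mono[of "\<alpha> * x" 1 "\<alpha> * x"] x \<alpha> by (simp add: algebra_simps)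
        also have "\<dots> \<le> exp (\<alpha> * x) * (1 - \<alpha> * x / 2)"
          using x by (intro mult_right_mono exp_ge_add_one_self) auto
        finally show ?thesis by (simp add: exp_minus field_simps)
      qed
      then have "K * q t r \<le> K * (1 - \<alpha> * x / 2)"
        using num_jumps_segment[OF \<open>segment k r t\<close>] False K0
        by (intro mult_left_mono) (auto simp: q_def x_def)
      ultimately show ?thesis by (simp add: algebra_simps)
    qed
    show ?case
    proof (intro allI impI)
      fix u assume u: "t \<le> u"
      have "\<Phi> u t *v (\<Phi> t r *v \<xi> r) = \<Phi> u r *v \<xi> r"
        using state_transition_matrix_solution[OF \<Phi> _ impulsive_solution_later[OF homogeneous], of t u]
          rt u short_step by simp
      then have "\<Phi> u t *v \<xi> t = \<Phi> u r *v \<xi> r + \<Phi> u t *v p t"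
        by (simp add: p_def matrix_vector_mult_diff_distrib)
      then have "norm (\<Phi> u t *v \<xi> t) \<le> norm (\<Phi> u r *v \<xi> r) + norm (\<Phi> u t *v p t)"
        using norm_triangle_ineq by metis
      also have "\<dots> \<le> K * q u r + M * q u t * norm (p t)"
        using short_step rt u bound[of t u "p t"] by (intro add_mono) (auto simp: q_def mult.assoc)
      also have "\<dots> = (K * q t r + M * norm (p t)) * q u t"
        using q_split[of r t u] rt u by (simp add: algebra_simps)
      also have "\<dots> \<le> K * q u t" using key q_pos[of u t] by (intro mult_right_mono) auto
      finally show "norm (\<Phi> u t *v \<xi> t) \<le> K * q u t" .
    qed
  qed
  then have "norm (\<xi> t) \<le> K" if "0 \<le> t" for t
    using that \<Phi> by (fastforce simp: q_def state_transition_matrix_def)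
  then show ?thesis by (rule that)
qed

end

context positive_impulsive_system
begin

text \<open>For small \<open>\<epsilon>\<close> the constant vector with entries \<open>\<epsilon>\<close> is a subsolution, because the forcing
outweighs every entry of \<open>\<epsilon> A 1\<close>.\<close>
lemma affine_solution_lower_bound:
  assumes \<xi>: "impulsive_solution b d 0 \<xi>" and "0 \<le> b" "0 \<le> d" and start: "\<And>i. \<epsilon> \<le> \<xi> 0 $ i"
    and \<epsilon>: "0 \<le> \<epsilon>" "\<And>i. \<epsilon> \<le> d $ i" "\<And>i. \<epsilon> * (a * norm (1 :: real ^ 'n)) \<le> b $ i" and t: "0 \<le> t"
  shows "\<epsilon> \<le> \<xi> t $ i"
proof -
  define e where "e = \<epsilon> *\<^sub>R (1 :: real ^ 'n)"
  have \<xi>_nonneg: "0 \<le> \<xi> t" if "0 \<le> t" for t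
    using impulsive_solution_nonneg[OF _ \<xi> \<open>0 \<le> b\<close> \<open>0 \<le> d\<close> _ that] start \<epsilon>(1)
    by (auto simp: less_eq_vec_def intro: order_trans)
  have "0 \<le> \<xi> t - e"
    using t zero_less_one
  proof (induction rule: segment_induct)
    case start
    then show ?case using assms by (simp add: e_def less_eq_vec_def)
  next
    case (short_step k r t)
    show ?case
    proof (rule segment_comparison[OF \<open>0 \<le> r\<close> \<open>segment k r t\<close>])
      fix u assume u: "u \<in> {r<..t}"
      show "((\<lambda>t. \<xi> t - e) has_vector_derivative A u *v \<xi> u + b) (at u within {r<..t})"
        using has_vector_derivative_diff[OF impulsive_solution_flow[OF \<xi> \<open>segment k r t\<close> \<open>0 \<le> r\<close> u]
            has_vector_derivative_const[of e]] by simp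
      have "0 \<le> u" using u \<open>0 \<le> r\<close> by simp
      have "- (b $ i) \<le> (A u *v e) $ i" for i
      proof -
        have "\<bar>(A u *v e) $ i\<bar> \<le> a * norm e"
          using component_le_norm_cart[of "A u *v e" i] A_bound[OF \<open>0 \<le> u\<close>, of e] by linarith
        also have "\<dots> \<le> b $ i" using \<epsilon>(1) \<epsilon>(3)[of i] by (simp add: e_def algebra_simps)
        finally show ?thesis by linarith
      qed
      then show "A u *v (\<xi> u - e) \<le> A u *v \<xi> u + b"
        by (simp add: less_eq_vec_def matrix_vector_mult_diff_distrib) (smt (verit))
    next
      show "((\<lambda>t. \<xi> t - e) \<longlongrightarrow> jump d r (\<xi> r) - e) (at_right r)"
        by (intro tendsto_intros impulsive_solution_at_right[OF \<xi> \<open>0 \<le> r\<close>])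
      show "0 \<le> jump d r (\<xi> r) - e"
      proof (cases "r \<in> \<tau> ` {1..}")
        case True
        then obtain j where j: "1 \<le> j" "r = \<tau> j" by auto
        have "0 \<le> J j *v \<xi> r"
          using nonneg_mat_mult[OF J_nonneg[OF j(1)] \<xi>_nonneg[OF \<open>0 \<le> r\<close>]] .
        then show ?thesis using j \<epsilon>(2)
          by (simp add: jump_at_impulse e_def less_eq_vec_def) (smt (verit))
      next
        case False
        then show ?thesis using short_step by (simp add: jump_elsewhere)
      qed
    qed
  qed
  then show ?thesis by (simp add: e_def less_eq_vec_def)
qed

text \<open>The forced solution with \<open>b + 1\<close> and \<open>d + 1\<close> started at time 0 serves all initial times
\<open>s < \<tau> 1\<close> at once.\<close>
lemma stable_imp_supersolution:
  fixes b d :: "real ^ 'n"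
  assumes stable: "uniformly_exp_stable A J \<tau>"
    and b: "0 \<prec> b" and d: "0 \<prec> d"
  shows "\<exists>\<xi>1 \<xi>2 \<xi>. 0 \<prec> \<xi>1 \<and> \<xi>1 \<le> \<xi>2 \<and>
    (\<forall>s\<in>{0..<\<tau> 1}.
      piecewise_C1 \<tau> s \<xi> \<and>
      (\<forall>t\<ge>s. \<xi>1 \<prec> \<xi> t \<and> \<xi> t \<prec> \<xi>2) \<and>
      (\<forall>k. \<forall>t\<in>flow_interval \<tau> s k.
        - vector_derivative \<xi> (at t within flow_interval \<tau> s k) + A t *v \<xi> t + b \<prec> 0) \<and>
      (\<forall>k\<ge>1. J k *v \<xi> (\<tau> k) - right_lim \<xi> (\<tau> k) + d \<prec> 0))"
proof -
  obtain \<Phi> M \<rho> \<alpha> where \<Phi>: "state_transition_matrix A J \<tau> \<Phi>"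
    and const: "0 < M" "\<rho> \<in> {0<..<1}" "0 < \<alpha>"
    and stab: "\<forall>t0\<in>{0..<\<tau> 1}. \<forall>s\<ge>t0. \<forall>t\<ge>s.
      onorm ((*v) (\<Phi> t s)) \<le> M * \<rho> ^ num_jumps \<tau> t s * exp (- \<alpha> * (t - s))"
    using stable unfolding uniformly_exp_stable_def ball_conj_distrib
    by (elim exE conjE bexE) (rule that)
  have bound: "norm (\<Phi> t s *v v) \<le> M * \<rho> ^ num_jumps \<tau> t s * exp (- \<alpha> * (t - s)) * norm v"
    if "0 \<le> s" "s \<le> t" for s t v
  proof -
    have "onorm ((*v) (\<Phi> t s)) \<le> M * \<rho> ^ num_jumps \<tau> t s * exp (- \<alpha> * (t - s))"
      using bspec[OF stab, of 0] first_pos that by simp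
    then have "onorm ((*v) (\<Phi> t s)) * norm v
        \<le> M * \<rho> ^ num_jumps \<tau> t s * exp (- \<alpha> * (t - s)) * norm v"
      by (rule mult_right_mono) simp
    then show ?thesis
      using onorm[OF matrix_vector_mul_bounded_linear, of "\<Phi> t s" v] by (rule order_trans[rotated])
  qed
  obtain \<xi> where \<xi>: "impulsive_solution (b + 1) (d + 1) 0 \<xi>" "\<xi> 0 = 1"
    using impulsive_solution_exists[of 0] by blast
  obtain K where K: "\<And>t. 0 \<le> t \<Longrightarrow> norm (\<xi> t) \<le> K"
    using affine_solution_bounded[OF \<Phi> bound _ _ _ _ \<xi>(1)] const by auto
  define \<epsilon> where "\<epsilon> = 1 / (1 + a * norm (1 :: real ^ 'n))"
  have \<epsilon>: "0 < \<epsilon>" "\<epsilon> \<le> 1" "\<epsilon> * (a * norm (1 :: real ^ 'n)) \<le> 1"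
    using a_nonneg by (auto simp: \<epsilon>_def add_pos_nonneg divide_le_eq)
  have b': "0 \<le> b $ i" "0 \<le> d $ i" for i using b d by (auto simp: vec_less_def less_imp_le)
  have lower: "\<epsilon> \<le> \<xi> t $ i" if "0 \<le> t" for t i
  proof (rule affine_solution_lower_bound[OF \<xi>(1) _ _ _ _ _ _ that])
    show "\<epsilon> * (a * norm (1 :: real ^ 'n)) \<le> (b + 1) $ i" for i
      using \<epsilon>(3) b'[of i] by simp
    show "\<epsilon> \<le> (d + 1) $ i" for i
      using \<epsilon>(2) b'[of i] by simp
  qed (use \<epsilon> b' \<xi>(2) in \<open>auto simp: less_eq_vec_def\<close>)
  define \<xi>1 \<xi>2 where "\<xi>1 = (\<epsilon> / 2) *\<^sub>R (1 :: real ^ 'n)" and "\<xi>2 = (K + 1) *\<^sub>R (1 :: real ^ 'n)"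
  have between: "\<xi>1 \<prec> \<xi> t \<and> \<xi> t \<prec> \<xi>2" if t: "0 \<le> t" for t
  proof -
    have "\<epsilon> / 2 < \<xi> t $ i" "\<xi> t $ i < K + 1" for i
      using lower[OF t, of i] \<epsilon>(1) K[OF t] component_le_norm_cart[of "\<xi> t" i] by linarith+
    then show ?thesis by (simp add: vec_less_def \<xi>1_def \<xi>2_def)
  qed
  have "\<xi>1 \<le> \<xi>2"
    using between[of 0] unfolding vec_less_def less_eq_vec_def by (meson less_imp_le less_trans order_refl)
  moreover have "0 \<prec> \<xi>1" using \<epsilon> by (simp add: vec_less_def \<xi>1_def)
  moreover have "piecewise_C1 \<tau> s \<xi> \<and>
      (\<forall>t\<ge>s. \<xi>1 \<prec> \<xi> t \<and> \<xi> t \<prec> \<xi>2) \<and>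
      (\<forall>k. \<forall>t\<in>flow_interval \<tau> s k.
        - vector_derivative \<xi> (at t within flow_interval \<tau> s k) + A t *v \<xi> t + b \<prec> 0) \<and>
      (\<forall>k\<ge>1. J k *v \<xi> (\<tau> k) - right_lim \<xi> (\<tau> k) + d \<prec> 0)" if s: "s \<in> {0..<\<tau> 1}" for s
  proof (intro conjI allI impI ballI)
    have sol: "impulsive_solution (b + 1) (d + 1) s \<xi>"
      using impulsive_solution_later[OF \<xi>(1)] s by simp
    note der = impulsive_solution_derivative[OF sol]
    have vd: "vector_derivative \<xi> (at t within flow_interval \<tau> s k) = A t *v \<xi> t + (b + 1)"
      if "t \<in> flow_interval \<tau> s k" for t k
      using vector_derivative_within[OF flow_interval_nontrivial[OF that] der[OF that]] .
    have later: "s \<le> \<tau> k" if "1 \<le> k" for k using impulse_le[of 1 k] that s by simp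
    show "piecewise_C1 \<tau> s \<xi>"
      unfolding piecewise_C1_def
    proof (intro conjI allI ballI impI)
      show "\<xi> differentiable (at t within flow_interval \<tau> s k)" if "t \<in> flow_interval \<tau> s k" for k t
        using der[OF that] by (rule differentiableI_vector)
      show "continuous_on (flow_interval \<tau> s k)
          (\<lambda>t. vector_derivative \<xi> (at t within flow_interval \<tau> s k))" for k
      proof -
        have "continuous_on (flow_interval \<tau> s k) \<xi>"
          unfolding continuous_on_eq_continuous_within
          by (intro ballI has_vector_derivative_continuous[OF der])
        moreover have "continuous_on (flow_interval \<tau> s k) A"
          by (rule continuous_on_subset[OF A_continuous]) (use s in \<open>auto simp: flow_interval_def\<close>)
        ultimately have "continuous_on (flow_interval \<tau> s k) (\<lambda>t. A t *v \<xi> t + (b + 1))"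
          unfolding matrix_vector_mult_def
          by (intro continuous_intros continuous_on_vec_lambda continuous_on_component)
        then show ?thesis using vd by (simp cong: continuous_on_cong)
      qed
      show "\<exists>l. (\<xi> \<longlongrightarrow> l) (at_right s)" using impulsive_solution_at_right[OF sol] by blast
      show "\<exists>l. (\<xi> \<longlongrightarrow> l) (at_right (\<tau> k))" if "1 \<le> k" for k
        using impulsive_solution_at_right[OF sol later[OF that]] by blast
    qed
    show "\<xi>1 \<prec> \<xi> t" "\<xi> t \<prec> \<xi>2" if "s \<le> t" for t
      using between[of t] that s by auto
    show "- vector_derivative \<xi> (at t within flow_interval \<tau> s k) + A t *v \<xi> t + b \<prec> 0"
      if "t \<in> flow_interval \<tau> s k" for t k
      by (simp add: vd[OF that] vec_less_def)
    show "J k *v \<xi> (\<tau> k) - right_lim \<xi> (\<tau> k) + d \<prec> 0" if "1 \<le> k" for k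
    proof -
      have "right_lim \<xi> (\<tau> k) = J k *v \<xi> (\<tau> k) + (d + 1)"
        unfolding right_lim_def
        using impulsive_solution_at_right[OF sol later[OF that]] that
        by (intro tendsto_Lim) (auto simp: jump_at_impulse)
      then show ?thesis by (simp add: vec_less_def)
    qed
  qed
  ultimately show ?thesis by blast
qed

end

section \<open>From a strict supersolution to a Lyapunov function\<close>

context positive_impulsive_system
begin

lemma nonneg_mat_mult_mono: "nonneg_mat M \<Longrightarrow> v \<le> w \<Longrightarrow> M *v v \<le> M *v w"
  using nonneg_mat_mult[of M "w - v"] by (simp add: less_eq_vec_def matrix_vector_mult_diff_distrib)

text \<open>With \<open>c = V(r, x r)\<close> the function \<open>c exp(-\<alpha> (t - r)) \<xi>(t)\<close> stays above \<open>x t\<close>; this gives the decay of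
\<open>V\<close> from \<open>r\<close> on. The argument is the same if \<open>r\<close> is an impulse, which settles the upper right
derivative at the right end of a flow interval, where it sees the values after the jump.\<close>
lemma supersolution_imp_lyapunov:
  fixes \<xi>1 \<xi>2 :: "real ^ 'n"
  assumes t0: "0 \<le> t0" "t0 < \<tau> 1"
    and \<xi>1: "0 \<prec> \<xi>1" and C1: "piecewise_C1 \<tau> t0 \<xi>"
    and between: "\<forall>t\<ge>t0. \<xi>1 \<prec> \<xi> t \<and> \<xi> t \<prec> \<xi>2"
    and flow: "\<forall>k. \<forall>t\<in>flow_interval \<tau> t0 k.
      - vector_derivative \<xi> (at t within flow_interval \<tau> t0 k) + A t *v \<xi> t + 1 \<prec> 0"
    and jumps: "\<forall>k\<ge>1. J k *v \<xi> (\<tau> k) - right_lim \<xi> (\<tau> k) + 1 \<prec> 0"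
  shows "uniform_lyapunov A J \<tau> t0 (\<lambda>t x. max_ratio x (\<xi> t))"
proof -
  define m where "m = Min (range (\<lambda>i. \<xi>1 $ i))"
  have m: "0 < m" using \<xi>1 by (auto simp: m_def vec_less_def)
  have m_le: "m \<le> \<xi>1 $ i" for i by (simp add: m_def)
  \<comment> \<open>A common upper bound for all components of \<open>\<xi>\<close>.\<close>
  define \<Xi> where "\<Xi> = norm \<xi>2 + 1"
  have \<Xi>: "0 < \<Xi>" by (simp add: \<Xi>_def add_nonneg_pos)
  have lower: "m \<le> \<xi> t $ i" if "t0 \<le> t" for t i
    using between that m_le[of i] unfolding vec_less_def by (meson less_imp_le order_trans)
  have upper: "\<xi> t $ i \<le> \<Xi>" if "t0 \<le> t" for t i
  proof -
    have "\<xi> t $ i < \<xi>2 $ i" using between that by (simp add: vec_less_def)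
    then show ?thesis using component_le_norm_cart[of \<xi>2 i] by (simp add: \<Xi>_def)
  qed
  have pos: "0 < \<xi> t $ i" if "t0 \<le> t" for t i using lower[OF that, of i] m by linarith
  define \<xi>p where "\<xi>p k = right_lim \<xi> (\<tau> k)" for k
  have \<xi>p: "(\<xi> \<longlongrightarrow> \<xi>p k) (at_right (\<tau> k))" if "1 \<le> k" for k
    unfolding \<xi>p_def by (rule piecewise_C1_right_limit[OF C1 that])
  have later: "t0 < \<tau> k" if "1 \<le> k" for k using impulse_le[of 1 k] that t0 by simp
  have near: "eventually (\<lambda>t. t0 \<le> t) (at_right (\<tau> k))" if "1 \<le> k" for k
    using eventually_at_right_less[of "\<tau> k"] by eventually_elim (use later[OF that] in simp)
  have \<xi>p_upper: "\<xi>p k $ i \<le> \<Xi>" if "1 \<le> k" for k i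
    by (rule tendsto_upperbound[OF tendsto_vec_nth[OF \<xi>p[OF that], of i]])
       (use near[OF that] upper in \<open>auto elim: eventually_mono\<close>)
  have \<xi>p_lower: "m \<le> \<xi>p k $ i" if "1 \<le> k" for k i
    by (rule tendsto_lowerbound[OF tendsto_vec_nth[OF \<xi>p[OF that], of i]])
       (use near[OF that] lower in \<open>auto elim: eventually_mono\<close>)
  have J_\<xi>: "(J k *v \<xi> (\<tau> k)) $ i + 1 \<le> \<xi>p k $ i" if "1 \<le> k" for k i
    using jumps that by (auto simp: vec_less_def \<xi>p_def less_imp_le algebra_simps)
  \<comment> \<open>The rate is chosen such that \<open>\<alpha> \<xi> \<le> 1\<close> and the factor such that \<open>(1 - \<rho>) \<xi>(\<tau>\<^sub>k\<^sup>+) \<le> 1\<close>: decay uses up the slack 1.\<close>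
  define \<alpha> where "\<alpha> = 1 / \<Xi>"
  define \<rho> where "\<rho> = 1 - 1 / (\<Xi> + 1)"
  have \<rho>: "0 < \<rho>" "\<rho> < 1" using \<Xi> by (auto simp: \<rho>_def field_simps)
  have \<rho>_jump: "\<xi>p k $ i - 1 \<le> \<rho> * \<xi>p k $ i" if "1 \<le> k" for k i
  proof -
    have "\<xi>p k $ i / (\<Xi> + 1) \<le> 1" using \<xi>p_upper[OF that, of i] \<Xi> by (simp add: divide_le_eq)
    then show ?thesis by (simp add: \<rho>_def algebra_simps)
  qed
  have decay: "max_ratio (x t) (\<xi> t) \<le> max_ratio (x r) (\<xi> r) * exp (- \<alpha> * (t - r))"
    if sol: "impulsive_solution 0 0 s x" and s: "t0 \<le> s" "s \<le> r" "t0 < r" and seg: "segment k r t"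
      and x: "0 \<le> x r" for s x r t k
  proof -
    define c where "c = max_ratio (x r) (\<xi> r)"
    have c: "0 \<le> c" unfolding c_def by (rule max_ratio_nonneg) (use pos s x in auto)
    have x_le: "x r \<le> c *\<^sub>R \<xi> r"
      using le_max_ratio_mult[of "\<xi> r" "x r"] pos s by (auto simp: less_eq_vec_def c_def)
    obtain l where l: "(\<xi> \<longlongrightarrow> l) (at_right r)" "jump 0 r (\<xi> r) \<le> l"
    proof (cases "r \<in> \<tau> ` {1..}")
      case True
      then obtain j where j: "1 \<le> j" "r = \<tau> j" by auto
      have "J j *v \<xi> (\<tau> j) \<le> \<xi>p j"
        using J_\<xi>[OF j(1)] unfolding less_eq_vec_def by (smt (verit))
      then show ?thesis using that \<xi>p[OF j(1)] j by (simp add: jump_at_impulse)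
    next
      case False
      then show ?thesis using that piecewise_C1_at_right[OF C1 \<open>t0 < r\<close>] by (simp add: jump_elsewhere)
    qed
    have jump_le: "jump 0 r (x r) \<le> c *\<^sub>R l"
    proof -
      have "jump 0 r (x r) \<le> jump 0 r (c *\<^sub>R \<xi> r)"
        using jump_nonneg[of 0 "c *\<^sub>R \<xi> r - x r" r] x_le jump_diff[of 0 r "c *\<^sub>R \<xi> r" 0 "x r", symmetric]
        by (simp add: less_eq_vec_def)
      also have "\<dots> = c *\<^sub>R jump 0 r (\<xi> r)" by (simp add: jump_def matrix_vector_mult_scaleR)
      also have "\<dots> \<le> c *\<^sub>R l" using l(2) c by (simp add: less_eq_vec_def mult_left_mono)
      finally show ?thesis .
    qed
    define e where "e u = exp (- \<alpha> * (u - r))" for u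
    have "0 \<le> (c * e t) *\<^sub>R \<xi> t - x t"
    proof (rule segment_comparison[OF _ seg])
      show "0 \<le> r" using t0 s by simp
      show "((\<lambda>u. (c * e u) *\<^sub>R \<xi> u - x u) \<longlongrightarrow> (c * e r) *\<^sub>R l - jump 0 r (x r)) (at_right r)"
        unfolding e_def
        by (intro tendsto_intros l impulsive_solution_at_right[OF sol s(2)])
      show "0 \<le> (c * e r) *\<^sub>R l - jump 0 r (x r)" using jump_le by (simp add: e_def)
      fix u assume u: "u \<in> {r<..t}"
      have sub: "{r<..t} \<subseteq> flow_interval \<tau> t0 k"
        using segment_subset_flow_interval[OF seg] s by auto
      let ?d = "vector_derivative \<xi> (at u within flow_interval \<tau> t0 k)"
      have d\<xi>: "(\<xi> has_vector_derivative ?d) (at u within {r<..t})"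
        by (rule has_vector_derivative_within_subset[OF piecewise_C1_derivative[OF C1] sub])
           (use u sub in auto)
      have "((\<lambda>u. c * e u) has_real_derivative - \<alpha> * (c * e u)) (at u within {r<..t})"
        unfolding e_def by (auto intro!: derivative_eq_intros)
      then show "((\<lambda>u. (c * e u) *\<^sub>R \<xi> u - x u) has_vector_derivative
          ((c * e u) *\<^sub>R ?d + (- \<alpha> * (c * e u)) *\<^sub>R \<xi> u) - (A u *v x u + 0)) (at u within {r<..t})"
        by (intro has_vector_derivative_diff has_vector_derivative_scaleR d\<xi>
              impulsive_solution_flow[OF sol seg s(2) u])
      have ineq: "(A u *v \<xi> u) $ i \<le> ?d $ i - \<alpha> * \<xi> u $ i" for i
      proof -
        have "\<alpha> * \<xi> u $ i \<le> 1" using upper[of u i] s u \<Xi> by (simp add: \<alpha>_def divide_le_eq)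
        moreover have "- ?d $ i + (A u *v \<xi> u) $ i + 1 < 0"
          using flow u sub by (force simp: vec_less_def)
        ultimately show ?thesis by linarith
      qed
      have "(c * e u) * (A u *v \<xi> u) $ i \<le> (c * e u) * (?d $ i - \<alpha> * \<xi> u $ i)" for i
        using c by (intro mult_left_mono ineq) (simp add: e_def)
      then show "A u *v ((c * e u) *\<^sub>R \<xi> u - x u)
          \<le> ((c * e u) *\<^sub>R ?d + (- \<alpha> * (c * e u)) *\<^sub>R \<xi> u) - (A u *v x u + 0)"
        by (simp add: less_eq_vec_def matrix_vector_mult_diff_distrib matrix_vector_mult_scaleR algebra_simps)
    qed
    moreover have "0 < \<xi> t $ i" for i using pos[of t i] s seg by (simp add: segment_def)
    ultimately show ?thesis
      by (subst max_ratio_le_iff) (auto simp: less_eq_vec_def c_def e_def)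
  qed
  have norm_equiv: "1 / \<Xi> * infnorm x \<le> max_ratio x (\<xi> t) \<and> max_ratio x (\<xi> t) \<le> 1 / m * infnorm x"
    if "t0 \<le> t" "0 \<le> x" for t x
  proof
    have V: "0 \<le> max_ratio x (\<xi> t)" by (rule max_ratio_nonneg) (use pos that in auto)
    have "\<bar>x $ i\<bar> \<le> max_ratio x (\<xi> t) * \<Xi>" for i
    proof -
      have "\<bar>x $ i\<bar> = x $ i" using that by (simp add: less_eq_vec_def)
      also have "\<dots> \<le> max_ratio x (\<xi> t) * \<xi> t $ i" by (rule le_max_ratio_mult) (rule pos[OF that(1)])
      also have "\<dots> \<le> max_ratio x (\<xi> t) * \<Xi>" using upper[OF that(1)] V by (rule mult_left_mono)
      finally show ?thesis .
    qed
    then have "infnorm x \<le> max_ratio x (\<xi> t) * \<Xi>" by (simp add: infnorm_le_iff)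
    then show "1 / \<Xi> * infnorm x \<le> max_ratio x (\<xi> t)" using \<Xi> by (simp add: divide_le_eq)
    have "x $ i \<le> 1 / m * infnorm x * \<xi> t $ i" for i
    proof -
      have "x $ i \<le> infnorm x" using component_le_infnorm_cart[of x i] by linarith
      also have "\<dots> = 1 / m * infnorm x * m" using m by simp
      also have "\<dots> \<le> 1 / m * infnorm x * \<xi> t $ i"
        using lower[OF that(1)] m by (intro mult_left_mono) (auto simp: infnorm_pos_le)
      finally show ?thesis .
    qed
    then show "max_ratio x (\<xi> t) \<le> 1 / m * infnorm x" by (subst max_ratio_le_iff) (auto simp: pos that)
  qed
  show ?thesis
    unfolding uniform_lyapunov_def
  proof (rule exI[of _ "1 / \<Xi>"], rule conjI[rotated], rule exI[of _ "1 / m"], rule conjI[rotated],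
      rule exI[of _ \<alpha>], rule conjI[rotated], rule bexI[of _ \<rho>], intro conjI allI impI ballI)
    show "0 < 1 / \<Xi>" "0 < 1 / m" "0 < \<alpha>" "\<rho> \<in> {0<..<1}" using \<Xi> m \<rho> by (auto simp: \<alpha>_def)
    fix s x assume s: "t0 \<le> s" and x: "solution_from A J \<tau> s x \<and> (\<forall>t\<ge>s. 0 \<le> x t)"
    have sol: "impulsive_solution 0 0 s x" using x s t0 solution_from_iff by auto
    show "1 / \<Xi> * infnorm (x t) \<le> max_ratio (x t) (\<xi> t)" "max_ratio (x t) (\<xi> t) \<le> 1 / m * infnorm (x t)"
      if "s \<le> t" for t
      using norm_equiv[of t "x t"] x s that by auto
    show "upper_right_deriv (\<lambda>u. max_ratio (x u) (\<xi> u)) t \<le> ereal (- \<alpha> * max_ratio (x t) (\<xi> t))"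
      if t: "t \<in> flow_interval \<tau> t0 k" "s \<le> t" for k t
    proof -
      obtain j where j: "0 < j \<Longrightarrow> \<tau> j \<le> t" "t < \<tau> (Suc j)" using ex_segment by blast
      have "t0 < t" using t by (simp add: flow_interval_def)
      show ?thesis
      proof (rule upper_right_deriv_exp_decay[OF j(2)])
        fix u assume u: "t < u" "u < \<tau> (Suc j)"
        then have "segment j t u" using j by (simp add: segment_def)
        then show "max_ratio (x u) (\<xi> u) \<le> max_ratio (x t) (\<xi> t) * exp (- \<alpha> * (u - t))"
          using decay[OF sol s t(2) \<open>t0 < t\<close>] x t by blast
      qed
    qed
    show "\<exists>L. ((\<lambda>u. max_ratio (x u) (\<xi> u)) \<longlongrightarrow> L) (at_right (\<tau> k)) \<and> L \<le> \<rho> * max_ratio (x (\<tau> k)) (\<xi> (\<tau> k))"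
      if k: "1 \<le> k" "s \<le> \<tau> k" for k
    proof (intro exI conjI)
      define c where "c = max_ratio (x (\<tau> k)) (\<xi> (\<tau> k))"
      have \<xi>p_pos: "0 < \<xi>p k $ i" for i using \<xi>p_lower[OF k(1), of i] m by linarith
      have pos_k: "0 < \<xi> (\<tau> k) $ i" for i using pos later[OF k(1)] by simp
      have c: "0 \<le> c" unfolding c_def by (rule max_ratio_nonneg) (use pos_k x k in auto)
      have "(x \<longlongrightarrow> J k *v x (\<tau> k)) (at_right (\<tau> k))"
        using impulsive_solution_at_right[OF sol k(2)] k by (simp add: jump_at_impulse)
      then show "((\<lambda>u. max_ratio (x u) (\<xi> u)) \<longlongrightarrow> max_ratio (J k *v x (\<tau> k)) (\<xi>p k)) (at_right (\<tau> k))"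
        by (rule tendsto_max_ratio[OF _ \<xi>p[OF k(1)]]) (use \<xi>p_pos less_irrefl in metis)
      have "x (\<tau> k) \<le> c *\<^sub>R \<xi> (\<tau> k)"
        using le_max_ratio_mult[of "\<xi> (\<tau> k)" "x (\<tau> k)"] pos_k by (auto simp: less_eq_vec_def c_def)
      then have le: "J k *v x (\<tau> k) \<le> c *\<^sub>R (J k *v \<xi> (\<tau> k))"
        using nonneg_mat_mult_mono[OF J_nonneg[OF k(1)]] by (metis matrix_vector_mult_scaleR)
      have "(J k *v x (\<tau> k)) $ i \<le> \<rho> * c * \<xi>p k $ i" for i
      proof -
        have "(J k *v x (\<tau> k)) $ i \<le> c * (J k *v \<xi> (\<tau> k)) $ i"
          using le by (simp add: less_eq_vec_def)
        also have "\<dots> \<le> c * (\<rho> * \<xi>p k $ i)"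
          using J_\<xi>[OF k(1), of i] \<rho>_jump[OF k(1), of i] c by (intro mult_left_mono) linarith+
        finally show ?thesis by (simp add: mult_ac)
      qed
      then show "max_ratio (J k *v x (\<tau> k)) (\<xi>p k) \<le> \<rho> * max_ratio (x (\<tau> k)) (\<xi> (\<tau> k))"
        using \<xi>p_pos by (simp add: max_ratio_le_iff c_def)
    qed
  qed
qed

end

section \<open>From a Lyapunov function to stability\<close>

context positive_impulsive_system
begin

text \<open>Three cases arise at the left end \<open>r\<close> of a segment. At an impulse the jump condition supplies the
factor \<open>\<rho>\<close>. At other times after \<open>t0\<close> the Lyapunov function is continuous from the right.
At \<open>t0\<close> itself \<open>\<xi>\<close> may be discontinuous, and the upper norm bound takes the place of continuity.\<close>
lemma lyapunov_decay:
  assumes t0: "0 \<le> t0" "t0 < \<tau> 1"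
    and C1: "piecewise_C1 \<tau> t0 \<xi>" and pos: "\<And>t i. t0 \<le> t \<Longrightarrow> 0 < \<xi> t $ i"
    and s: "t0 \<le> s" and sol: "impulsive_solution 0 0 s x"
    and upper: "\<And>t. s \<le> t \<Longrightarrow> max_ratio (x t) (\<xi> t) \<le> c * infnorm (x t)"
    and dini: "\<And>k t. t \<in> flow_interval \<tau> t0 k \<Longrightarrow> s \<le> t \<Longrightarrow>
      upper_right_deriv (\<lambda>u. max_ratio (x u) (\<xi> u)) t \<le> ereal (- \<alpha> * max_ratio (x t) (\<xi> t))"
    and jumps: "\<And>k. 1 \<le> k \<Longrightarrow> s \<le> \<tau> k \<Longrightarrow> \<exists>L. ((\<lambda>u. max_ratio (x u) (\<xi> u)) \<longlongrightarrow> L) (at_right (\<tau> k)) \<and>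
      L \<le> \<rho> * max_ratio (x (\<tau> k)) (\<xi> (\<tau> k))"
    and \<rho>: "0 < \<rho>" and t: "s \<le> t"
  shows "max_ratio (x t) (\<xi> t) \<le> c * infnorm (x s) * \<rho> ^ num_jumps \<tau> t s * exp (- \<alpha> * (t - s))"
proof -
  define f where "f t = max_ratio (x t) (\<xi> t)" for t
  define B where "B t = c * infnorm (x s) * \<rho> ^ num_jumps \<tau> t s * exp (- \<alpha> * (t - s))" for t
  have "f t \<le> B t"
    using t zero_less_one
  proof (induction rule: segment_induct)
    case start
    then show ?case using upper[of s] by (simp add: f_def B_def)
  next
    case (short_step k r t)
    note seg = \<open>segment k r t\<close> and sr = \<open>s \<le> r\<close>
    have rt: "r < t" using seg by (simp add: segment_def)
    have sub0: "{r<..t} \<subseteq> flow_interval \<tau> t0 k"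
      using segment_subset_flow_interval[OF seg] s sr by auto
    have sub: "{r<..t} \<subseteq> flow_interval \<tau> s k"
      using segment_subset_flow_interval[OF seg sr] .
    have x_cont: "continuous_on {r<..t} x"
      unfolding continuous_on_eq_continuous_within
      by (intro ballI has_vector_derivative_continuous[OF impulsive_solution_flow[OF sol seg sr]])
    have f_cont: "continuous_on {r<..t} f"
      unfolding continuous_on_def f_def
    proof
      fix v assume v: "v \<in> {r<..t}"
      have "\<xi> v $ i \<noteq> 0" for i using pos[of v i] v s sr by auto
      then show "((\<lambda>u. max_ratio (x u) (\<xi> u)) \<longlongrightarrow> max_ratio (x v) (\<xi> v)) (at v within {r<..t})"
        using v x_cont continuous_on_subset[OF piecewise_C1_continuous_on[OF C1] sub0]
        by (intro tendsto_max_ratio) (auto simp: continuous_on_def)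
    qed
    have decay: "f t \<le> f u * exp (- \<alpha> * (t - u))" if u: "r < u" "u < t" for u
    proof (rule dini_decay)
      show "continuous_on {u..t} f" by (rule continuous_on_subset[OF f_cont]) (use u in auto)
      show "upper_right_deriv f v \<le> ereal (- \<alpha> * f v)" if "u \<le> v" "v < t" for v
        unfolding f_def by (rule dini[of v k]) (use that u sub0 sr in auto)
    qed (use u in simp)
    obtain W B0 where W: "(W \<longlongrightarrow> B0) (at_right r)" "\<And>u. r < u \<Longrightarrow> f u \<le> W u"
      and B0: "B0 \<le> B r * \<rho> ^ num_jumps \<tau> t r"
    proof (cases "r \<in> \<tau> ` {1..}")
      case True
      then obtain j where j: "1 \<le> j" "r = \<tau> j" by auto
      obtain L where L: "(f \<longlongrightarrow> L) (at_right r)" "L \<le> \<rho> * f r"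
        using jumps[OF j(1)] sr j(2) unfolding f_def by blast
      have "\<rho> * f r \<le> \<rho> * B r" using short_step \<rho> by simp
      then have "L \<le> B r * \<rho> ^ num_jumps \<tau> t r"
        using L(2) num_jumps_segment[OF seg] True by (simp add: mult.commute)
      then show ?thesis using that L(1) by blast
    next
      case False
      then have none: "num_jumps \<tau> t r = 0" using num_jumps_segment[OF seg] by simp
      have x_right: "(x \<longlongrightarrow> x r) (at_right r)"
        using impulsive_solution_at_right[OF sol sr] False by (simp add: jump_elsewhere)
      show ?thesis
      proof (cases "r = t0")
        case True
        have "((\<lambda>u. c * infnorm (x u)) \<longlongrightarrow> c * infnorm (x r)) (at_right r)"
          by (intro tendsto_intros tendsto_infnorm x_right)
        moreover have "f u \<le> c * infnorm (x u)" if "r < u" for u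
          using upper[of u] that sr by (simp add: f_def)
        moreover have "r = s" using True s sr by simp
        ultimately show ?thesis using that none by (simp add: B_def)
      next
        case False
        then have "t0 < r" using s sr by simp
        then have \<xi>_right: "(\<xi> \<longlongrightarrow> \<xi> r) (at_right r)"
          using piecewise_C1_at_right[OF C1] \<open>r \<notin> \<tau> ` {1..}\<close> by blast
        have "\<xi> r $ i \<noteq> 0" for i using pos[of r i] s sr by auto
        then have "(f \<longlongrightarrow> f r) (at_right r)"
          unfolding f_def by (intro tendsto_max_ratio x_right \<xi>_right)
        then show ?thesis using that none short_step by (metis mult.right_neutral order_refl power_0)
      qed
    qed
    have "f t \<le> B0 * exp (- \<alpha> * (t - r))"
      by (rule decay_from_right_limit[OF rt decay _ W(1)]) (use W(2) in auto)
    also have "\<dots> \<le> (B r * \<rho> ^ num_jumps \<tau> t r) * exp (- \<alpha> * (t - r))"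
      using B0 by (intro mult_right_mono) auto
    also have "\<dots> = B t"
      using num_jumps_split[of s r t] sr rt
      by (simp add: B_def power_add algebra_simps flip: exp_add)
    finally show ?case .
  qed
  then show ?thesis by (simp add: f_def B_def)
qed

text \<open>The constant grows in three steps: first for nonnegative states from time \<open>t0\<close> on, then for all
states by splitting them into positive and negative part, and last for starting times before \<open>t0\<close>,
where the impulse-free interval up to \<open>t0\<close> costs the factor \<open>G\<close>.\<close>
lemma lyapunov_imp_stable:
  fixes \<xi>1 \<xi>2 :: "real ^ 'n"
  assumes t0: "0 \<le> t0" "t0 < \<tau> 1"
    and \<xi>1: "0 \<prec> \<xi>1" and C1: "piecewise_C1 \<tau> t0 \<xi>"
    and between: "\<forall>t\<ge>t0. \<xi>1 \<prec> \<xi> t \<and> \<xi> t \<prec> \<xi>2"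
    and lyap: "uniform_lyapunov A J \<tau> t0 (\<lambda>t x. max_ratio x (\<xi> t))"
  shows "uniformly_exp_stable A J \<tau>"
proof -
  obtain \<Phi> where \<Phi>: "state_transition_matrix A J \<tau> \<Phi>" using state_transition_matrix_exists ..
  obtain c1 c2 \<alpha> \<rho> where c: "0 < c1" "0 < c2" "0 < \<alpha>" "\<rho> \<in> {0<..<1}"
    and V: "\<forall>s\<ge>t0. \<forall>x. solution_from A J \<tau> s x \<and> (\<forall>t\<ge>s. 0 \<le> x t) \<longrightarrow>
      (\<forall>t\<ge>s. c1 * infnorm (x t) \<le> max_ratio (x t) (\<xi> t) \<and> max_ratio (x t) (\<xi> t) \<le> c2 * infnorm (x t)) \<and>
      (\<forall>k. \<forall>t\<in>flow_interval \<tau> t0 k. s \<le> t \<longrightarrow>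
        upper_right_deriv (\<lambda>u. max_ratio (x u) (\<xi> u)) t \<le> ereal (- \<alpha> * max_ratio (x t) (\<xi> t))) \<and>
      (\<forall>k\<ge>1. s \<le> \<tau> k \<longrightarrow> (\<exists>L. ((\<lambda>u. max_ratio (x u) (\<xi> u)) \<longlongrightarrow> L) (at_right (\<tau> k)) \<and>
        L \<le> \<rho> * max_ratio (x (\<tau> k)) (\<xi> (\<tau> k))))"
    using lyap unfolding uniform_lyapunov_def by (elim exE conjE bexE) (rule that)
  have \<rho>: "0 < \<rho>" "\<rho> < 1" using c by auto
  have pos: "0 < \<xi> t $ i" if "t0 \<le> t" for t i
    using between \<xi>1 that less_trans unfolding vec_less_def zero_index by blast
  define q where "q t s = \<rho> ^ num_jumps \<tau> t s * exp (- \<alpha> * (t - s))" for t s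
  have q_pos: "0 < q t s" for t s using \<rho> by (simp add: q_def)
  have q_split: "q t s = q t r * q r s" if "s \<le> r" "r \<le> t" for t r s
    using num_jumps_split[OF that] by (simp add: q_def power_add algebra_simps flip: exp_add)
  have \<Phi>_start: "\<Phi> s s *v v = v" and \<Phi>_sol: "impulsive_solution 0 0 s (\<lambda>t. \<Phi> t s *v v)"
    if "0 \<le> s" for s v
    using \<Phi> that by (simp_all add: state_transition_matrix_def flip: solution_from_iff)
  define C where "C = sqrt DIM(real ^ 'n) * (c2 / c1)"
  have C: "0 \<le> C" using c by (simp add: C_def)
  have orthant: "norm (\<Phi> t s *v v) \<le> C * q t s * norm v" if s: "t0 \<le> s" "s \<le> t" and v: "0 \<le> v" for s t v
  proof -
    define x where "x t = \<Phi> t s *v v" for t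
    have s0: "0 \<le> s" using t0 s by simp
    have sol: "impulsive_solution 0 0 s x" using \<Phi>_sol[OF s0] by (simp add: x_def[abs_def])
    have xs: "x s = v" using \<Phi>_start[OF s0] by (simp add: x_def)
    have nonneg: "\<forall>t\<ge>s. 0 \<le> x t" using impulsive_solution_nonneg[OF s0 sol] v xs by simp
    have "solution_from A J \<tau> s x" using sol s0 by (simp add: solution_from_iff)
    then have V': "\<forall>t\<ge>s. c1 * infnorm (x t) \<le> max_ratio (x t) (\<xi> t) \<and> max_ratio (x t) (\<xi> t) \<le> c2 * infnorm (x t)"
      "\<forall>k. \<forall>t\<in>flow_interval \<tau> t0 k. s \<le> t \<longrightarrow>
        upper_right_deriv (\<lambda>u. max_ratio (x u) (\<xi> u)) t \<le> ereal (- \<alpha> * max_ratio (x t) (\<xi> t))"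
      "\<forall>k\<ge>1. s \<le> \<tau> k \<longrightarrow> (\<exists>L. ((\<lambda>u. max_ratio (x u) (\<xi> u)) \<longlongrightarrow> L) (at_right (\<tau> k)) \<and>
        L \<le> \<rho> * max_ratio (x (\<tau> k)) (\<xi> (\<tau> k)))"
      using V[rule_format, OF s(1), of x] nonneg by blast+
    have "c1 * infnorm (x t) \<le> max_ratio (x t) (\<xi> t)" using V'(1) s by blast
    also have "\<dots> \<le> c2 * infnorm (x s) * \<rho> ^ num_jumps \<tau> t s * exp (- \<alpha> * (t - s))"
      by (rule lyapunov_decay[OF t0 C1 pos s(1) sol _ _ _ \<rho>(1) s(2)]) (use V' in blast)+
    also have "\<dots> = c2 * q t s * infnorm v" by (simp add: q_def xs)
    also have "\<dots> \<le> c2 * q t s * norm v"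
      using c q_pos[of t s] by (intro mult_left_mono infnorm_le_norm) simp
    finally have "infnorm (x t) \<le> c2 / c1 * q t s * norm v"
      using c by (simp add: field_simps)
    then have "sqrt DIM(real ^ 'n) * infnorm (x t) \<le> sqrt DIM(real ^ 'n) * (c2 / c1 * q t s * norm v)"
      by (intro mult_left_mono) auto
    then show ?thesis using norm_le_infnorm[of "x t"] by (simp add: C_def x_def mult.assoc)
  qed
  have after: "norm (\<Phi> t s *v v) \<le> 2 * C * q t s * norm v" if s: "t0 \<le> s" "s \<le> t" for s t v
  proof -
    define vp vn :: "real ^ 'n" where "vp = (\<chi> i. max (v $ i) 0)" and "vn = (\<chi> i. max (- v $ i) 0)"
    have "v = vp - vn" by (simp add: vec_eq_iff vp_def vn_def max_def)
    moreover have norms: "norm vp \<le> norm v" "norm vn \<le> norm v"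
      by (rule norm_le_componentwise_cart; simp add: vp_def vn_def max_def)+
    have nonneg: "0 \<le> vp" "0 \<le> vn" by (auto simp: vp_def vn_def less_eq_vec_def)
    have "norm (\<Phi> t s *v w) \<le> C * q t s * norm v" if "0 \<le> w" "norm w \<le> norm v" for w
    proof -
      have "C * q t s * norm w \<le> C * q t s * norm v"
        using that C q_pos[of t s] by (intro mult_left_mono) auto
      then show ?thesis using orthant[OF s that(1)] by linarith
    qed
    from this[OF nonneg(1) norms(1)] this[OF nonneg(2) norms(2)]
    have "norm (\<Phi> t s *v (vp - vn)) \<le> 2 * (C * q t s * norm v)"
      using norm_triangle_ineq4[of "\<Phi> t s *v vp" "\<Phi> t s *v vn"]
      by (simp add: matrix_vector_mult_diff_distrib)
    ultimately show ?thesis by (simp add: mult.assoc)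
  qed
  define G where "G = exp ((a + 1 + \<alpha>) * t0)"
  have before: "norm (\<Phi> t s *v v) \<le> G * q t s * norm v" if s: "0 \<le> s" "s \<le> t" "t \<le> t0" for s t v
  proof (cases "s = t")
    case True
    have "norm v \<le> G * norm v"
      using t0 a_nonneg c by (intro mult_right_mono[of 1 G, simplified]) (auto simp: G_def)
    then show ?thesis using True \<Phi>_start[OF s(1)] by (simp add: q_def)
  next
    case False
    then have seg: "segment 0 s t" using s t0 by (simp add: segment_def)
    have no_jump: "s \<notin> \<tau> ` {1..}" using impulse_le[of 1] s t0 by fastforce
    have "norm (\<Phi> t s *v v) \<le> norm v * exp ((a + 1) * (t - s))"
      using impulsive_solution_growth[OF s(1) \<Phi>_sol[OF s(1), of v] seg order_refl]
      by (simp add: jump_elsewhere[OF no_jump] \<Phi>_start[OF s(1)])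
    also have "exp ((a + 1) * (t - s)) = exp ((a + 1 + \<alpha>) * (t - s)) * exp (- \<alpha> * (t - s))"
      by (simp add: algebra_simps flip: exp_add)
    also have "\<dots> \<le> G * exp (- \<alpha> * (t - s))"
      unfolding G_def using s t0 a_nonneg c by (intro mult_right_mono) (auto intro!: mult_left_mono)
    finally have "norm (\<Phi> t s *v v) \<le> norm v * (G * exp (- \<alpha> * (t - s)))"
      by (simp add: mult_left_mono)
    then show ?thesis using num_jumps_segment[OF seg] no_jump by (simp add: q_def mult_ac)
  qed
  define M where "M = (2 * C + 1) * G"
  have G: "1 \<le> G" using t0 a_nonneg c by (simp add: G_def)
  have M: "0 < M" using C G by (simp add: M_def)
  have all: "norm (\<Phi> t s *v v) \<le> M * q t s * norm v" if s: "0 \<le> s" "s \<le> t" for s t v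
  proof -
    have weaken: "K * q t s * norm v \<le> M * q t s * norm v" if "K \<le> M" for K
      using that q_pos[of t s] by (intro mult_right_mono) auto
    consider "t \<le> t0" | "t0 \<le> s" | "s < t0" "t0 < t" by linarith
    then show ?thesis
    proof cases
      case 1
      have "G \<le> M" using mult_right_mono[of 1 "2 * C + 1" G] C G by (simp add: M_def)
      then show ?thesis using before[OF s 1, of v] weaken by (meson order_trans)
    next
      case 2
      have "(2 * C + 1) * 1 \<le> M" unfolding M_def using C G by (intro mult_left_mono) auto
      then have "2 * C \<le> M" by simp
      then show ?thesis using after[OF 2 s(2), of v] weaken by (meson order_trans)
    next
      case 3
      have "impulsive_solution 0 0 t0 (\<lambda>t. \<Phi> t s *v v)"
        by (rule impulsive_solution_later[OF \<Phi>_sol[OF s(1)]]) (use 3 in simp)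
      then have "\<Phi> t s *v v = \<Phi> t t0 *v (\<Phi> t0 s *v v)"
        by (rule state_transition_matrix_solution[OF \<Phi> t0(1)]) (use 3 in simp)
      then have "norm (\<Phi> t s *v v) \<le> 2 * C * q t t0 * norm (\<Phi> t0 s *v v)"
        using after[of t0 t "\<Phi> t0 s *v v"] 3 by simp
      also have "\<dots> \<le> 2 * C * q t t0 * (G * q t0 s * norm v)"
        using before[of s t0 v] 3 s C q_pos[of t t0] by (intro mult_left_mono) auto
      also have "\<dots> = (2 * C * G) * q t s * norm v" using q_split[of s t0 t] 3 by simp
      also have "\<dots> \<le> M * q t s * norm v" using G by (intro weaken) (simp add: M_def algebra_simps)
      finally show ?thesis .
    qed
  qed
  show ?thesis
    unfolding uniformly_exp_stable_def
  proof (rule exI[of _ \<Phi>], rule conjI[OF \<Phi>], rule exI[of _ M], rule conjI[OF M], rule bexI[of _ \<rho>],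
      rule exI[of _ \<alpha>], rule conjI[OF c(3)], intro ballI conjI allI impI)
    fix s0 assume s0: "s0 \<in> {0..<\<tau> 1}"
    show "norm (x t) \<le> M * \<rho> ^ num_jumps \<tau> t s0 * exp (- \<alpha> * (t - s0)) * norm (x s0)"
      if "solution_from A J \<tau> s0 x" "s0 \<le> t" for x t
    proof -
      have "x t = \<Phi> t s0 *v x s0"
        using state_transition_matrix_solution[OF \<Phi>] that s0 by (simp add: solution_from_iff)
      then show ?thesis using all[of s0 t "x s0"] s0 that by (simp add: q_def mult.assoc)
    qed
    show "onorm ((*v) (\<Phi> t s)) \<le> M * \<rho> ^ num_jumps \<tau> t s * exp (- \<alpha> * (t - s))"
      if "s0 \<le> s" "s \<le> t" for s t
      using all[of s t] that s0 by (intro onorm_le) (simp add: q_def mult.assoc)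
  qed (rule c(4))
qed

end

section \<open>The equivalence\<close>

lemma bounded_matrices_imp_uniform_bound:
  fixes A :: "'t \<Rightarrow> real ^ 'n ^ 'm"
  assumes "bounded (A ` T)"
  obtains a where "\<And>t v. t \<in> T \<Longrightarrow> norm (A t *v v) \<le> a * norm v"
proof -
  obtain B where B: "\<And>t. t \<in> T \<Longrightarrow> norm (A t) \<le> B" using assms by (auto simp: bounded_iff)
  define a where "a = real CARD('m) * real CARD('n) * B"
  have "norm (A t *v v) \<le> a * norm v" if t: "t \<in> T" for t v
  proof -
    have "\<bar>A t $ i $ j\<bar> \<le> B" for i j
      using component_le_norm_cart[of "A t $ i" j] Finite_Cartesian_Product.norm_nth_le[of "A t" i] B[OF t] by linarith
    then have "onorm ((*v) (A t)) \<le> a" unfolding a_def by (rule onorm_le_matrix_component)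
    then have "onorm ((*v) (A t)) * norm v \<le> a * norm v" by (rule mult_right_mono) simp
    then show ?thesis using onorm[OF matrix_vector_mul_bounded_linear, of "A t" v] by linarith
  qed
  then show ?thesis by (rule that)
qed

theorem lemma2p7:
  fixes A :: "real \<Rightarrow> real ^ 'n ^ 'n"
    and J :: "nat \<Rightarrow> real ^ 'n ^ 'n"
    and \<tau> :: "nat \<Rightarrow> real"
    and t0 :: real
  assumes t0: "0 \<le> t0" "t0 < \<tau> 1"
    and impulse_times: "\<And>k. k \<ge> 1 \<Longrightarrow> \<tau> (Suc k) - \<tau> k > 0"
      "filterlim \<tau> at_top sequentially"
    and A_cont: "continuous_on {0..} A"
    and A_bounded: "bounded (A ` {0..})"
    and J_bounded: "bounded (J ` {1..})"
    and A_metzler: "\<And>t. t \<ge> 0 \<Longrightarrow> metzler (A t)"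
    and J_nonneg: "\<And>k. k \<ge> 1 \<Longrightarrow> nonneg_mat (J k)"
  shows
    "(uniformly_exp_stable A J \<tau> \<longleftrightarrow>
       (\<exists>\<xi>1 \<xi>2 \<xi>. 0 \<prec> \<xi>1 \<and> \<xi>1 \<le> \<xi>2 \<and> piecewise_C1 \<tau> t0 \<xi> \<and>
          (\<forall>t\<ge>t0. \<xi>1 \<prec> \<xi> t \<and> \<xi> t \<prec> \<xi>2) \<and>
          uniform_lyapunov A J \<tau> t0 (\<lambda>t x. Max (range (\<lambda>i. x $ i / \<xi> t $ i))))) \<and>
     (uniformly_exp_stable A J \<tau> \<longleftrightarrow>
       (\<forall>b d. 0 \<prec> b \<and> 0 \<prec> d \<longrightarrow>
          (\<exists>\<xi>1 \<xi>2 \<xi>. 0 \<prec> \<xi>1 \<and> \<xi>1 \<le> \<xi>2 \<and>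
             (\<forall>s\<in>{0..<\<tau> 1}.
                piecewise_C1 \<tau> s \<xi> \<and>
                (\<forall>t\<ge>s. \<xi>1 \<prec> \<xi> t \<and> \<xi> t \<prec> \<xi>2) \<and>
                (\<forall>k. \<forall>t\<in>flow_interval \<tau> s k.
                   - vector_derivative \<xi> (at t within flow_interval \<tau> s k) + A t *v \<xi> t + b \<prec> 0) \<and>
                (\<forall>k\<ge>1. J k *v \<xi> (\<tau> k) - right_lim \<xi> (\<tau> k) + d \<prec> 0)))))"
  (is "(?a \<longleftrightarrow> ?b) \<and> (?a \<longleftrightarrow> ?c)")
proof -
  obtain a where a: "\<And>t v. t \<in> {0..} \<Longrightarrow> norm (A t *v v) \<le> a * norm v"
    using bounded_matrices_imp_uniform_bound[OF A_bounded] by blast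
  interpret positive_impulsive_system \<tau> A J a
    by unfold_locales (use assms a in auto)
  have ac: ?c if ?a
    using stable_imp_supersolution[OF that] by blast
  have cb: ?b if c: ?c
  proof -
    have "0 \<prec> (1 :: real ^ 'n)" by (simp add: vec_less_def)
    note supersolution = mp[OF spec[OF spec[OF c, of 1], of 1] conjI[OF this this]]
    then obtain \<xi>1 \<xi>2 :: "real ^ 'n" and \<xi> where \<xi>: "0 \<prec> \<xi>1" "\<xi>1 \<le> \<xi>2"
      and super: "\<forall>s\<in>{0..<\<tau> 1}.
        piecewise_C1 \<tau> s \<xi> \<and>
        (\<forall>t\<ge>s. \<xi>1 \<prec> \<xi> t \<and> \<xi> t \<prec> \<xi>2) \<and>
        (\<forall>k. \<forall>t\<in>flow_interval \<tau> s k.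
          - vector_derivative \<xi> (at t within flow_interval \<tau> s k) + A t *v \<xi> t + 1 \<prec> 0) \<and>
        (\<forall>k\<ge>1. J k *v \<xi> (\<tau> k) - right_lim \<xi> (\<tau> k) + 1 \<prec> 0)"
      by (elim exE conjE) (rule that)
    have "t0 \<in> {0..<\<tau> 1}" using t0 by simp
    note at_t0 = bspec[OF super this]
    have "uniform_lyapunov A J \<tau> t0 (\<lambda>t x. max_ratio x (\<xi> t))"
      using supersolution_imp_lyapunov[OF t0 \<xi>(1)] at_t0 by blast
    then show ?b using \<xi> at_t0 unfolding max_ratio_def by blast
  qed
  have ba: ?a if ?b
    using that lyapunov_imp_stable[OF t0] unfolding max_ratio_def by blast
  show ?thesis using ac cb ba by blast
qed

end
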